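(* Let $G$ be an abelian group of order $a^2b^2$, where $a,b$ are positive integers with $\gcd(a,b)=1$, $a>1$, and $b$ odd with $b\ge 3$. Let $\epsilon\in\{1,-1\}$ and let $D$ be an $(a^2b^2,\ r(ab-\epsilon),\ \epsilon ab+r^2-3\epsilon r,\ r^2-\epsilon r)$-partial difference set in $G$, and let $t$ be the integer with $$t\le \frac{\epsilon ab-2\epsilon r+a}{2a}<t+1.$$ Then: (i) if $\epsilon=1$ (i.e. $D$ is a Latin square type PDS), either $$\frac{(a+1)b(b+1-2t)}{2(b+1)}-(b-1)\le r\le \frac{(a+1)b(b+1-2t)}{2(b+1)}$$ or $$\frac{(a-1)b(b-1-2t)}{2(b-1)}\le r\le \frac{(a-1)b(b-1-2t)}{2(b-1)}+(b+1);$$ (ii) if $\epsilon=-1$ (i.e. $D$ is a negative Latin square type PDS), either $$\frac{(a+1)b(b-1+2t)}{2(b-1)}-(b+1)\le r\le \frac{(a+1)b(b-1+2t)}{2(b-1)}$$ or $$\frac{(a-1)b(b+1+2t)}{2(b+1)}\le r\le \frac{(a-1)b(b+1+2t)}{2(b+1)}+(b-1).$$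
   Context: For a finite abelian group $G$ of order $v$, a subset $D\subseteq G$ of size $k$ is a $(v,k,\lambda,\mu)$-partial difference set (PDS) if the expressions $gh^{-1}$ with $g,h\in D$, $g\ne h$, represent each non-identity element of $D$ exactly $\lambda$ times and each non-identity element of $G\setminus D$ exactly $\mu$ times. A PDS with parameters $(n^2, r(n-\epsilon), \epsilon n+r^2-3\epsilon r, r^2-\epsilon r)$ is of Latin square type if $\epsilon=1$ and of negative Latin square type if $\epsilon=-1$. *)

theory Defs
  imports "HOL-Algebra.Algebra"
begin

definition pds :: "('a, 'b) monoid_scheme \<Rightarrow> 'a set \<Rightarrow> int \<Rightarrow> int \<Rightarrow> int \<Rightarrow> int \<Rightarrow> bool" where
  "pds G D v k lam mu \<longleftrightarrow>
     finite (carrier G) \<and> int (card (carrier G)) = v \<and>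
     D \<subseteq> carrier G \<and> int (card D) = k \<and>
     (\<forall>g \<in> carrier G - {\<one>\<^bsub>G\<^esub>}.
        int (card {(x, y). x \<in> D \<and> y \<in> D \<and> x \<noteq> y \<and> x \<otimes>\<^bsub>G\<^esub> inv\<^bsub>G\<^esub> y = g})
          = (if g \<in> D then lam else mu))"

end

theory Submission
  imports "Jordan_Normal_Form.Char_Poly" "HOL-Number_Theory.Residues" Defs
begin

text \<open>
  Write \<open>n = a b\<close> and let \<open>N\<close>, \<open>H\<close> be the subgroups of \<open>G\<close> of order \<open>a\<^sup>2\<close>, \<open>b\<^sup>2\<close>. If \<open>2 r = n\<close> then \<open>t = 0\<close>
  and the bounds are trivial. Otherwise \<open>\<lambda> \<noteq> \<mu>\<close>, so \<open>D\<close> is inverse-closed and omits the identity, and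
  every nontrivial character takes one of the values \<open>- eps r\<close>, \<open>- eps r + eps n\<close> on \<open>D\<close>. The characters
  with the second value form a set \<open>T\<close> in the dual group, and \<open>D\<close> and \<open>T\<close> play symmetric roles.
  Counting \<open>p\<close>-tuples in \<open>D\<close> with a given product modulo primes \<open>p\<close> not dividing \<open>n\<close> shows that \<open>D\<close>,
  hence \<open>T\<close>, is closed under all powers prime to \<open>n\<close>.

  A nontrivial character \<open>\<psi>\<close> of \<open>N\<close> satisfies \<open>\<psi>(D \<inter> N) = - eps r + eps a m\<close>, where \<open>b m\<close> counts the
  extensions of \<open>\<psi>\<close> to \<open>G\<close> lying in \<open>T\<close>. As \<open>\<psi>(D \<inter> N)\<close> is an algebraic integer, \<open>m\<close> is an integer; as \<open>b\<close>
  is odd, inverting the \<open>H\<close>-component pairs the extensions and \<open>m\<close> is odd exactly when the extension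
  trivial on \<open>H\<close> lies in \<open>T\<close>. The first two moments of \<open>m\<close> are functions of \<open>k = |D \<inter> N|\<close>, and
  \<open>(m - v)\<^sup>2 \<ge> 1\<close> whenever \<open>m\<close> and \<open>v\<close> have different parity, so every integer \<open>v\<close> yields an inequality
  between \<open>k\<close> and the analogous number \<open>l\<close> for \<open>T\<close>. Adding the same inequality with \<open>D\<close> and \<open>T\<close>
  exchanged, for two consecutive values of \<open>v\<close> determined by \<open>t\<close>, pins down \<open>k = l\<close> exactly. The bounds
  on \<open>r\<close> express that the number of nontrivial characters in \<open>T\<close> that are trivial on \<open>N\<close>, an affine
  function of \<open>k\<close>, lies between \<open>0\<close> and \<open>b\<^sup>2 - 1\<close>.
\<close>

section \<open>Rational eigenvalues and prime-order permutations\<close>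

text \<open>The characteristic polynomial of an integer matrix is monic and integral, so the
  eigenvalue is an algebraic integer; a rational one is an integer. The index set is arbitrary
  because it will be a group.\<close>

lemma rational_eigenvalue_of_int_matrix:
  fixes M :: "'x \<Rightarrow> 'x \<Rightarrow> int" and u :: "'x \<Rightarrow> complex"
  assumes fin: "finite I" and x0: "x0 \<in> I" "u x0 \<noteq> 0"
    and eig: "\<And>x. x \<in> I \<Longrightarrow> (\<Sum>y\<in>I. of_int (M x y) * u y) = l * u x"
    and l: "l \<in> \<rat>"
  shows "l \<in> \<int>"
proof -
  define n where "n = card I"
  obtain e where e: "bij_betw e {0..<n} I"
    using ex_bij_betw_nat_finite[OF fin] n_def by auto
  define A :: "int mat" where "A = mat n n (\<lambda>(i, j). M (e i) (e j))"
  define B :: "complex mat" where "B = map_mat of_int A"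
  define v where "v = vec n (\<lambda>i. u (e i))"
  have A: "A \<in> carrier_mat n n" and B: "B \<in> carrier_mat n n" and v: "v \<in> carrier_vec n"
    by (auto simp: A_def B_def v_def)
  obtain i0 where i0: "i0 < n" "e i0 = x0"
    using e x0 unfolding bij_betw_def by auto
  have "v \<noteq> 0\<^sub>v n"
  proof
    assume "v = 0\<^sub>v n"
    hence "v $ i0 = 0" using i0 by simp
    thus False using i0 x0 by (simp add: v_def)
  qed
  moreover have "B *\<^sub>v v = l \<cdot>\<^sub>v v"
  proof (rule eq_vecI)
    fix i assume "i < dim_vec (l \<cdot>\<^sub>v v)"
    hence i: "i < n" by (simp add: v_def)
    have "(B *\<^sub>v v) $ i = (\<Sum>j = 0..<n. of_int (M (e i) (e j)) * u (e j))"
      using i by (simp add: B_def A_def v_def scalar_prod_def)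
    also have "\<dots> = (\<Sum>y\<in>I. of_int (M (e i) y) * u y)"
      by (rule sum.reindex_bij_betw[OF e])
    also have "\<dots> = l * u (e i)"
      using e i by (intro eig) (auto simp: bij_betw_def)
    finally show "(B *\<^sub>v v) $ i = (l \<cdot>\<^sub>v v) $ i" using i by (simp add: v_def)
  qed (simp add: B_def A_def v_def)
  ultimately have "eigenvalue B l"
    unfolding eigenvalue_def eigenvector_def using B v by (intro exI[of _ v]) auto
  hence "poly (char_poly B) l = 0" using eigenvalue_root_char_poly[OF B] by simp
  moreover have "char_poly B = map_poly of_int (char_poly A)"
    unfolding B_def by (rule of_int_hom.char_poly_hom[OF A])
  moreover have "Polynomial.lead_coeff (char_poly B) = 1" using degree_monic_char_poly[OF B] by simp
  ultimately have "algebraic_int l"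
    by (intro algebraic_int.intros[of "char_poly B"]) (auto simp: coeff_map_poly)
  thus ?thesis using l rational_algebraic_int_is_int by blast
qed

section \<open>Fixed points of maps of prime order\<close>

lemma funpow_prime_fixpoint:
  assumes p: "Factorial_Ring.prime p" and ord: "(f ^^ p) x = x" and k: "(f ^^ k) x = x" "0 < k" "k < p"
  shows "f x = x"
proof -
  have mult: "(f ^^ (k * i)) x = x" for i
    by (induction i) (simp_all add: funpow_add k)
  have multp: "(f ^^ (p * i)) x = x" for i
    by (induction i) (simp_all add: funpow_add ord)
  have "coprime k p"
    using p k by (metis coprime_commute dvd_imp_le leD prime_imp_coprime)
  then obtain i j where "k * i = p * j + 1"
    using bezout_nat[of k p] k by auto
  hence "(f ^^ (p * j + 1)) x = x" using mult by metis
  moreover have "(f ^^ (1 + p * j)) x = f x" unfolding funpow_add using multp by simp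
  ultimately show ?thesis by (simp add: add.commute)
qed

text \<open>The orbit of a non-fixed point has exactly \<open>p\<close> elements; removing it
  changes neither the residue of the cardinality nor the fixed points.\<close>

lemma card_cong_card_fixpoints:
  assumes p: "Factorial_Ring.prime p" and fin: "finite S"
    and cl: "\<And>x. x \<in> S \<Longrightarrow> f x \<in> S" and ord: "\<And>x. x \<in> S \<Longrightarrow> (f ^^ p) x = x"
  shows "[card S = card {x \<in> S. f x = x}] (mod p)"
  using fin cl ord
proof (induction S rule: finite_psubset_induct)
  case (psubset S)
  show ?case
  proof (cases "\<exists>x\<in>S. f x \<noteq> x")
    case False
    hence "{x \<in> S. f x = x} = S" by auto
    thus ?thesis by simp
  next
    case True
    then obtain x where x: "x \<in> S" "f x \<noteq> x" by auto
    have p0: "p > 0" using p by (simp add: prime_gt_0_nat)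
    define O' where "O' = (\<lambda>i. (f ^^ i) x) ` {..<p}"
    have inS: "(f ^^ i) x \<in> S" for i
      by (induction i) (auto simp: x psubset.prems)
    have sub: "O' \<subseteq> S" unfolding O'_def using inS by auto
    have xO: "x \<in> O'" unfolding O'_def using p0 by (auto intro!: image_eqI[of _ _ 0])
    \<comment> \<open>Applying \<open>f ^^ (p - i)\<close> to a repetition makes
      \<open>j - i\<close>, positive and below \<open>p\<close>, a period of \<open>x\<close>, so
      that \<open>x\<close> would be fixed.\<close>
    have key: False if "(f ^^ i) x = (f ^^ j) x" "i < j" "j < p" for i j
    proof -
      have "(f ^^ (p - i + i)) x = (f ^^ (p - i)) ((f ^^ j) x)"
        using that(1) by (simp only: funpow_add o_apply)
      also have "\<dots> = (f ^^ (j - i + p)) x"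
        using that by (simp add: add.commute flip: funpow_add o_apply[of "f ^^ (p - i)"])
      also have "\<dots> = (f ^^ (j - i)) x" using psubset.prems(2)[OF x(1)] by (simp add: funpow_add)
      finally have "(f ^^ (j - i)) x = x" using psubset.prems(2)[OF x(1)] that by simp
      thus False
        using funpow_prime_fixpoint[OF p psubset.prems(2)[OF x(1)], of "j - i"] that x
        by (simp add: less_imp_diff_less)
    qed
    hence "inj_on (\<lambda>i. (f ^^ i) x) {..<p}"
      by (intro inj_onI) (metis lessThan_iff linorder_neqE_nat)
    hence cardO: "card O' = p" unfolding O'_def by (simp add: card_image)
    have step: "f y \<in> O'" if "y \<in> O'" for y
    proof -
      obtain i where i: "y = (f ^^ i) x" "i < p" using \<open>y \<in> O'\<close> O'_def by auto
      show ?thesis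
      proof (cases "Suc i < p")
        case True thus ?thesis unfolding O'_def i by (auto intro!: image_eqI[of _ _ "Suc i"])
      next
        case False
        hence "Suc i = p" using i by simp
        hence "f y = x" using i psubset.prems(2)[OF x(1)] by (metis funpow.simps(2) o_apply)
        thus ?thesis using xO by simp
      qed
    qed
    \<comment> \<open>\<open>f ^^ (p - 1)\<close> undoes \<open>f\<close>, so no point outside the
      orbit is mapped into it and \<open>S - O'\<close> is closed under \<open>f\<close>.\<close>
    have pull: "y \<in> O'" if "y \<in> S" "f y \<in> O'" for y
    proof -
      have "(f ^^ i) (f y) \<in> O'" for i by (induction i) (auto simp: that step)
      from this[of "p - 1"] have "(f ^^ Suc (p - 1)) y \<in> O'" by (simp add: funpow_swap1)
      thus ?thesis using p0 psubset.prems(2)[OF that(1)] by simp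
    qed
    have nofix: "f y \<noteq> y" if "y \<in> O'" for y
    proof
      assume fy: "f y = y"
      obtain i where i: "y = (f ^^ i) x" "i < p" using \<open>y \<in> O'\<close> O'_def by auto
      have fp: "(f ^^ j) y = y" for j by (induction j) (auto simp: fy)
      have "(f ^^ (p - i)) y = (f ^^ p) x" using i by (simp flip: funpow_add o_apply[of "f ^^ (p - i)"])
      hence "y = x" using fp psubset.prems(2)[OF x(1)] by simp
      thus False using fy x by simp
    qed
    have fin: "finite O'" using sub psubset.hyps finite_subset by auto
    have "[card (S - O') = card {x \<in> S - O'. f x = x}] (mod p)"
      by (rule psubset.IH) (use xO x sub psubset.prems pull in auto)
    moreover have "{x \<in> S - O'. f x = x} = {x \<in> S. f x = x}" using nofix by auto
    moreover have "card S = card (S - O') + p"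
      using card_Diff_subset[OF fin sub] card_mono[OF psubset.hyps sub] cardO by simp
    ultimately show ?thesis by (simp add: cong_def)
  qed
qed

section \<open>Torsion subgroups of finite abelian groups\<close>

lemma power_coprime_eq_1:
  fixes z :: complex
  assumes "z ^ m = 1" "z ^ n = 1" "coprime m n" "m \<noteq> 0"
  shows "z = 1"
proof -
  obtain i j where ij: "m * i = n * j + 1" using bezout_nat[of m n] assms by auto
  have "z ^ (m * i) = 1" "z ^ (n * j) = 1" using assms by (simp_all add: power_mult)
  thus ?thesis using ij by simp
qed

text \<open>In a group of order \<open>m * n\<close> with \<open>m\<close>, \<open>n\<close> coprime
  this is the unique subgroup of order \<open>m\<close>.\<close>

definition torsion :: "('a, 'b) monoid_scheme \<Rightarrow> nat \<Rightarrow> 'a set" where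
  "torsion G m = {x \<in> carrier G. x [^]\<^bsub>G\<^esub> m = \<one>\<^bsub>G\<^esub>}"

lemma (in group) pow_coprime_eq_one:
  fixes m n :: nat
  assumes "x \<in> carrier G" "x [^] m = \<one>" "x [^] n = \<one>" "coprime m n"
  shows "x = \<one>"
proof -
  have "ord x dvd m" "ord x dvd n" using assms pow_eq_id by blast+
  hence "ord x = 1" using assms(4) by (metis coprime_common_divisor_nat)
  thus ?thesis using assms(1) ord_eq_1 by blast
qed

lemma (in group) nat_pow_cong:
  fixes m n k :: nat
  assumes "x \<in> carrier G" "x [^] k = \<one>" "[m = n] (mod k)"
  shows "x [^] m = x [^] n"
proof -
  have "x [^] m = x [^] (m mod k)" for m
  proof -
    have "x [^] m = (x [^] k) [^] (m div k) \<otimes> x [^] (m mod k)"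
      using assms(1) by (simp add: nat_pow_pow nat_pow_mult)
    thus ?thesis using assms by simp
  qed
  thus ?thesis using assms(3) by (metis cong_def)
qed

context comm_group
begin

lemma torsion_subgroup: "subgroup (torsion G m) G"
  unfolding torsion_def
  by unfold_locales (auto simp: nat_pow_distrib nat_pow_inv)

lemma torsion_Int_torsion:
  assumes "coprime m n" "x \<in> torsion G m" "x \<in> torsion G n"
  shows "x = \<one>"
  using assms pow_coprime_eq_one unfolding torsion_def by blast

text \<open>By Cauchy's theorem (Sylow with exponent 1), a common prime would give a nontrivial
  element killed both by \<open>m\<close> and by a prime factor of \<open>n\<close>.\<close>

lemma coprime_card_torsion:
  assumes fin: "finite (carrier G)" and cop: "coprime m n"
  shows "coprime (card (torsion G m)) n"
proof (rule ccontr)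
  assume "\<not> coprime (card (torsion G m)) n"
  then obtain p where p: "Factorial_Ring.prime p" "p dvd card (torsion G m)" "p dvd n"
    using prime_factor_nat[of "gcd (card (torsion G m)) n"]
    by (auto simp: coprime_iff_gcd_eq_1)
  let ?K = "G\<lparr>carrier := torsion G m\<rparr>"
  interpret K: group ?K by (rule subgroup_imp_group[OF torsion_subgroup])
  have finT: "finite (torsion G m)" using fin by (simp add: torsion_def)
  obtain c where c: "order ?K = p ^ 1 * c" using p(2) by (auto simp: order_def)
  obtain P where P: "subgroup P ?K" "card P = p ^ 1"
    using sylow_thm[OF p(1) K.group_axioms c] finT by auto
  have "card P > 1" using P prime_gt_1_nat[OF p(1)] by simp
  hence "\<not> P \<subseteq> {\<one>}" using card_mono[of "{\<one>}" P] by auto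
  then obtain x where x: "x \<in> P" "x \<noteq> \<one>" by auto
  have xT: "x \<in> torsion G m" using P(1) x(1) subgroup.subset by fastforce
  have P': "subgroup P G" using P(1) torsion_subgroup incl_subgroup by blast
  interpret P: group "G\<lparr>carrier := P\<rparr>" by (rule subgroup_imp_group[OF P'])
  have "x [^]\<^bsub>G\<lparr>carrier := P\<rparr>\<^esub> order (G\<lparr>carrier := P\<rparr>) = \<one>"
    using P.pow_order_eq_1 x(1) by auto
  hence "x [^] p = \<one>" using P(2) by (simp add: order_def nat_pow_consistent[symmetric])
  moreover have "coprime m p" using cop p(3) by (metis coprime_divisors dvd_refl)
  ultimately show False
    using xT x(2) pow_coprime_eq_one unfolding torsion_def by blast
qed

text \<open>The group is the internal direct product of its \<open>m\<close>-torsion and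
  \<open>n\<close>-torsion, so their orders multiply to \<open>m * n\<close>. By coprimality the
  orders divide \<open>m\<close> and \<open>n\<close> respectively, hence equal them.\<close>

lemma card_torsion:
  assumes fin: "finite (carrier G)" and ord: "order G = m * n" and cop: "coprime m n"
  shows "card (torsion G m) = m"
proof -
  have pos: "m * n > 0" using ord fin by (metis order_gt_0_iff_finite)
  obtain i j where ij: "m * i = n * j + 1" using bezout_nat[of m n] cop pos by auto
  have "bij_betw (\<lambda>(x, y). x \<otimes> y) (torsion G m \<times> torsion G n) (carrier G)"
  proof (rule bij_betw_imageI)
    show "inj_on (\<lambda>(x, y). x \<otimes> y) (torsion G m \<times> torsion G n)"
    proof (rule inj_onI, clarify)
      fix x y x' y'
      assume A: "x \<in> torsion G m" "y \<in> torsion G n" "x' \<in> torsion G m" "y' \<in> torsion G n"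
        "x \<otimes> y = x' \<otimes> y'"
      hence c: "x \<in> carrier G" "y \<in> carrier G" "x' \<in> carrier G" "y' \<in> carrier G"
        by (auto simp: torsion_def)
      have e: "inv x' \<otimes> x = y' \<otimes> inv y"
      proof -
        have "inv x' \<otimes> (x \<otimes> y) \<otimes> inv y = inv x' \<otimes> (x' \<otimes> y') \<otimes> inv y" using A(5) by simp
        thus ?thesis using c by (simp add: m_assoc) (simp add: m_assoc[symmetric])
      qed
      have "inv x' \<otimes> x \<in> torsion G m" "y' \<otimes> inv y \<in> torsion G n"
        using A torsion_subgroup by (meson subgroup.m_closed subgroup.m_inv_closed)+
      hence "inv x' \<otimes> x = \<one>" using torsion_Int_torsion[OF cop] e by simp
      hence "inv x' \<otimes> x = inv x' \<otimes> x'" "y' \<otimes> inv y = y \<otimes> inv y" using e c by simp_all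
      thus "x = x' \<and> y = y'" using c by (metis inv_closed l_cancel r_cancel)
    qed
    show "(\<lambda>(x, y). x \<otimes> y) ` (torsion G m \<times> torsion G n) = carrier G"
    proof
      show "(\<lambda>(x, y). x \<otimes> y) ` (torsion G m \<times> torsion G n) \<subseteq> carrier G"
        by (auto simp: torsion_def)
      show "carrier G \<subseteq> (\<lambda>(x, y). x \<otimes> y) ` (torsion G m \<times> torsion G n)"
      proof
        fix x assume x: "x \<in> carrier G"
        have o: "x [^] (m * n) = \<one>" using pow_order_eq_1[OF x] ord by simp
        \<comment> \<open>As \<open>m * i = n * j + 1\<close>, \<open>x\<close> is the product of
          these two powers, killed by \<open>n\<close> and \<open>m\<close> respectively.\<close>
        let ?y = "x [^] (m * i)" and ?z = "inv (x [^] (n * j))"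
        have "?y [^] n = (x [^] (m * n)) [^] i" using x by (simp add: nat_pow_pow ac_simps)
        hence y: "?y \<in> torsion G n" using x o by (simp add: torsion_def)
        have "(x [^] (n * j)) [^] m = (x [^] (m * n)) [^] j" using x by (simp add: nat_pow_pow ac_simps)
        hence z: "?z \<in> torsion G m" using x o by (simp add: torsion_def nat_pow_inv)
        have "?y = x [^] (n * j) \<otimes> x" using ij x by simp
        hence "?z \<otimes> ?y = x" using x by (simp add: m_assoc[symmetric])
        thus "x \<in> (\<lambda>(x, y). x \<otimes> y) ` (torsion G m \<times> torsion G n)"
          using y z by (intro image_eqI[of _ _ "(?z, ?y)"]) auto
      qed
    qed
  qed
  hence eq: "card (torsion G m) * card (torsion G n) = m * n"
    using bij_betw_same_card ord unfolding order_def by (fastforce simp: card_cartesian_product)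
  have "card (torsion G m) dvd m"
    using coprime_card_torsion[OF fin cop] coprime_dvd_mult_left_iff[of "card (torsion G m)" n m]
    by (simp flip: eq)
  moreover have "card (torsion G n) dvd n"
    using coprime_card_torsion[OF fin, of n m] cop
      coprime_dvd_mult_right_iff[of "card (torsion G n)" m n]
    by (simp add: coprime_commute flip: eq)
  ultimately obtain c d where "m = card (torsion G m) * c" "n = card (torsion G n) * d"
    by (auto elim!: dvdE)
  hence "m * n = (m * n) * (c * d)" using eq by (metis mult.assoc mult.left_commute)
  hence "c = 1" using pos by simp
  thus ?thesis using \<open>m = card (torsion G m) * c\<close> by simp
qed

end

text \<open>Translation by \<open>c\<close> permutes \<open>K\<close> and multiplies the sum by
  \<open>f c\<close>, which differs from 1.\<close>

lemma (in group) sum_nontrivial_hom_eq_0: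
  fixes f :: "'a \<Rightarrow> complex"
  assumes K: "subgroup K G"
    and hom: "\<And>x y. x \<in> K \<Longrightarrow> y \<in> K \<Longrightarrow> f (x \<otimes> y) = f x * f y"
    and c: "c \<in> K" "f c \<noteq> 1"
  shows "(\<Sum>x\<in>K. f x) = 0"
proof -
  have sub: "K \<subseteq> carrier G" using K subgroup.subset by blast
  have "bij_betw (\<lambda>x. c \<otimes> x) K K"
  proof (rule bij_betw_byWitness[where f' = "\<lambda>x. inv c \<otimes> x"])
    show "\<forall>x\<in>K. inv c \<otimes> (c \<otimes> x) = x" "\<forall>x\<in>K. c \<otimes> (inv c \<otimes> x) = x"
      using sub c by (auto simp: m_assoc[symmetric] subset_iff)
  qed (use K c in \<open>auto simp: subgroup.m_closed subgroup.m_inv_closed\<close>)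
  hence "(\<Sum>x\<in>K. f x) = (\<Sum>x\<in>K. f (c \<otimes> x))" by (simp add: sum.reindex_bij_betw)
  also have "\<dots> = f c * (\<Sum>x\<in>K. f x)" using hom c by (simp add: sum_distrib_left)
  finally show ?thesis using c by (metis mult_cancel_right2 mult.commute)
qed

section \<open>Dual pairs of finite abelian groups\<close>

text \<open>A perfect pairing, with \<open>B\<close> as a model of the dual of \<open>A\<close>. The
  axioms are symmetric, so every result can also be read with the groups exchanged; this lets the
  difference set and its dual change places.\<close>

locale dual_pair = A: comm_group A + B: comm_group B
  for A :: "('a, 'm) monoid_scheme" and B :: "('b, 'n) monoid_scheme" +
  fixes w :: "'a \<Rightarrow> 'b \<Rightarrow> complex"
  assumes finite_A: "finite (carrier A)" and finite_B: "finite (carrier B)"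
    and mult_left: "\<lbrakk>x \<in> carrier A; y \<in> carrier A; c \<in> carrier B\<rbrakk> \<Longrightarrow> w (x \<otimes>\<^bsub>A\<^esub> y) c = w x c * w y c"
    and mult_right: "\<lbrakk>x \<in> carrier A; c \<in> carrier B; d \<in> carrier B\<rbrakk> \<Longrightarrow> w x (c \<otimes>\<^bsub>B\<^esub> d) = w x c * w x d"
    and nonzero: "\<lbrakk>x \<in> carrier A; c \<in> carrier B\<rbrakk> \<Longrightarrow> w x c \<noteq> 0"
    and nondeg_left: "\<lbrakk>x \<in> carrier A; x \<noteq> \<one>\<^bsub>A\<^esub>\<rbrakk> \<Longrightarrow> \<exists>c\<in>carrier B. w x c \<noteq> 1"
    and nondeg_right: "\<lbrakk>c \<in> carrier B; c \<noteq> \<one>\<^bsub>B\<^esub>\<rbrakk> \<Longrightarrow> \<exists>x\<in>carrier A. w x c \<noteq> 1"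
begin

lemma swap: "dual_pair B A (\<lambda>c x. w x c)"
  by unfold_locales
    (auto simp: finite_A finite_B mult_left mult_right nonzero nondeg_left nondeg_right)

lemma one_left: "c \<in> carrier B \<Longrightarrow> w \<one>\<^bsub>A\<^esub> c = 1"
  using mult_left[of "\<one>\<^bsub>A\<^esub>" "\<one>\<^bsub>A\<^esub>" c] nonzero[of "\<one>\<^bsub>A\<^esub>" c] by simp

lemma one_right: "x \<in> carrier A \<Longrightarrow> w x \<one>\<^bsub>B\<^esub> = 1"
  using mult_right[of x "\<one>\<^bsub>B\<^esub>" "\<one>\<^bsub>B\<^esub>"] nonzero[of x "\<one>\<^bsub>B\<^esub>"] by simp

lemma pow_left: "\<lbrakk>x \<in> carrier A; c \<in> carrier B\<rbrakk> \<Longrightarrow> w (x [^]\<^bsub>A\<^esub> (k::nat)) c = w x c ^ k"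
  by (induction k) (simp_all add: one_left mult_left)

lemma pow_right: "\<lbrakk>x \<in> carrier A; c \<in> carrier B\<rbrakk> \<Longrightarrow> w x (c [^]\<^bsub>B\<^esub> (k::nat)) = w x c ^ k"
  by (induction k) (simp_all add: one_right mult_right)

lemma sum_right_eq_0:
  assumes "x \<in> carrier A" "x \<noteq> \<one>\<^bsub>A\<^esub>"
  shows "(\<Sum>c\<in>carrier B. w x c) = 0"
proof -
  obtain c where "c \<in> carrier B" "w x c \<noteq> 1" using nondeg_left assms by blast
  thus ?thesis
    using B.sum_nontrivial_hom_eq_0[OF B.subgroup_self, of "w x" c] assms by (simp add: mult_right)
qed

lemma sum_right:
  "x \<in> carrier A \<Longrightarrow> (\<Sum>c\<in>carrier B. w x c) = of_nat (order B) * of_bool (x = \<one>\<^bsub>A\<^esub>)"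
  using sum_right_eq_0 by (simp add: one_left order_def)

text \<open>Orthogonality evaluates the sum of \<open>w\<close> over all pairs in two orders of
  summation, once to each group order.\<close>

lemma order_eq: "order A = order B"
proof -
  interpret C: dual_pair B A "\<lambda>c x. w x c" by (rule swap)
  have "complex_of_nat (order B) = (\<Sum>x\<in>carrier A. \<Sum>c\<in>carrier B. w x c)"
    by (simp add: sum_right finite_A of_bool_def if_distrib cong: if_cong)
  also have "\<dots> = (\<Sum>c\<in>carrier B. \<Sum>x\<in>carrier A. w x c)" by (rule sum.swap)
  also have "\<dots> = of_nat (order A)"
    by (simp add: C.sum_right finite_B of_bool_def if_distrib cong: if_cong)
  finally show ?thesis by (metis of_nat_eq_iff)
qed

end

section \<open>Extension of characters and the character group\<close>

definition character_on :: "('a, 'b) monoid_scheme \<Rightarrow> 'a set \<Rightarrow> ('a \<Rightarrow> complex) \<Rightarrow> bool" where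
  "character_on G K \<chi> \<longleftrightarrow>
    (\<forall>x\<in>K. \<forall>y\<in>K. \<chi> (x \<otimes>\<^bsub>G\<^esub> y) = \<chi> x * \<chi> y) \<and> (\<forall>x\<in>K. \<chi> x \<noteq> 0)"

lemma complex_root_exists:
  fixes c :: complex
  assumes "m > 0"
  obtains z where "z ^ m = c"
proof (cases "c = 0")
  case True
  thus ?thesis using that[of 0] assms by simp
next
  case False
  hence "card {z. z ^ m = c} = m" using assms by (intro card_nth_roots) auto
  hence "{z. z ^ m = c} \<noteq> {}" using assms by (metis card.empty less_numeral_extra(3))
  thus ?thesis using that by auto
qed

lemma nontrivial_root_of_unity_exists:
  assumes "m > 1"
  obtains z :: complex where "z ^ m = 1" "z \<noteq> 1"
proof -
  have "card {z::complex. z ^ m = 1} = m" using assms by (intro card_roots_unity_eq) auto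
  hence "\<not> {z::complex. z ^ m = 1} \<subseteq> {1}" using card_mono[of "{1::complex}" "{z. z ^ m = 1}"] assms by auto
  thus ?thesis using that by auto
qed

context comm_group
begin

lemma character_on_one: "subgroup K G \<Longrightarrow> character_on G K \<chi> \<Longrightarrow> \<chi> \<one> = 1"
  unfolding character_on_def using subgroup.one_closed[of K G] l_one[OF one_closed]
  by (metis mult_cancel_right1)

lemma character_on_pow:
  assumes "subgroup K G" "character_on G K \<chi>" "x \<in> K"
  shows "x [^] (k::nat) \<in> K \<and> \<chi> (x [^] k) = \<chi> x ^ k"
  using assms character_on_one[OF assms(1,2)]
  by (induction k) (auto simp: character_on_def subgroup.one_closed subgroup.m_closed)

text \<open>On the subgroup generated by \<open>K\<close> and \<open>y\<close>, the value at
  \<open>k \<otimes> y [^] j\<close> is set to \<open>\<chi> k * z ^ j\<close>. This is consistent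
  because a power of \<open>y\<close> lies in \<open>K\<close> only if \<open>m\<close> divides its
  exponent.\<close>

lemma extend_character:
  fixes m :: nat
  assumes fin: "finite (carrier G)" and K: "subgroup K G" and \<chi>: "character_on G K \<chi>"
    and y: "y \<in> carrier G" and m: "m > 0" "y [^] m \<in> K"
    and least: "\<And>j. 0 < j \<Longrightarrow> j < m \<Longrightarrow> y [^] j \<notin> K"
    and z: "z ^ m = \<chi> (y [^] m)"
  obtains K' \<chi>' where "subgroup K' G" "K \<subseteq> K'" "y \<in> K'" "character_on G K' \<chi>'"
    "\<And>x. x \<in> K \<Longrightarrow> \<chi>' x = \<chi> x" "\<chi>' y = z"
proof -
  have Kc: "\<And>k. k \<in> K \<Longrightarrow> k \<in> carrier G" using K subgroup.subset by blast
  have hom: "\<And>k l. k \<in> K \<Longrightarrow> l \<in> K \<Longrightarrow> \<chi> (k \<otimes> l) = \<chi> k * \<chi> l"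
    and nz: "\<And>k. k \<in> K \<Longrightarrow> \<chi> k \<noteq> 0" using \<chi> by (auto simp: character_on_def)
  have one: "\<chi> \<one> = 1" by (rule character_on_one[OF K \<chi>])
  have z0: "z \<noteq> 0" using z nz[OF m(2)] m(1) by (auto simp: power_0_left)
  \<comment> \<open>Dividing \<open>d\<close> by \<open>m\<close> leaves a remainder whose power of
    \<open>y\<close> is also in \<open>K\<close>, so minimality of \<open>m\<close> makes the
    remainder 0.\<close>
  have pow_in_K: "\<chi> (y [^] d) = z ^ d" if d: "y [^] d \<in> K" for d :: nat
  proof -
    have split: "y [^] d = (y [^] m) [^] (d div m) \<otimes> y [^] (d mod m)"
      using y by (simp add: nat_pow_pow nat_pow_mult)
    have q: "(y [^] m) [^] (d div m) \<in> K" "\<chi> ((y [^] m) [^] (d div m)) = (z ^ m) ^ (d div m)"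
      using character_on_pow[OF K \<chi> m(2)] z by simp_all
    have "y [^] (d mod m) = inv ((y [^] m) [^] (d div m)) \<otimes> y [^] d"
      unfolding split using y by (simp add: m_assoc[symmetric])
    hence "y [^] (d mod m) \<in> K" using q d K by (simp add: subgroup.m_closed subgroup.m_inv_closed)
    hence "d mod m = 0" using least[of "d mod m"] m(1) by (meson mod_less_divisor neq0_conv)
    moreover have "d = m * (d div m) + d mod m" by simp
    ultimately have "z ^ d = (z ^ m) ^ (d div m)" by (metis add_0_right power_mult)
    thus ?thesis using split q \<open>d mod m = 0\<close> y by simp
  qed
  have wd: "\<chi> k * z ^ i = \<chi> l * z ^ j"
    if H: "k \<in> K" "l \<in> K" "k \<otimes> y [^] i = l \<otimes> y [^] j" "i \<le> j" for k l and i j :: nat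
  proof -
    have "k \<otimes> y [^] i = (l \<otimes> y [^] (j - i)) \<otimes> y [^] i"
      using H Kc y by (simp add: m_assoc nat_pow_mult)
    hence kl: "k = l \<otimes> y [^] (j - i)" using H Kc y by simp
    hence "y [^] (j - i) = inv l \<otimes> k" using H Kc y by (simp add: m_assoc[symmetric])
    hence "y [^] (j - i) \<in> K" using H K by (simp add: subgroup.m_closed subgroup.m_inv_closed)
    hence "\<chi> k = \<chi> l * z ^ (j - i)" using kl H pow_in_K hom by simp
    thus ?thesis using H(4) by (simp flip: power_add)
  qed
  have wd': "\<chi> k * z ^ i = \<chi> l * z ^ j"
    if "k \<in> K" "l \<in> K" "k \<otimes> y [^] i = l \<otimes> y [^] j" for k l and i j :: nat
    using wd[of k l i j] wd[of l k j i] that by (cases "i \<le> j") auto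
  define K' where "K' = {k \<otimes> y [^] j | k j. k \<in> K \<and> (j::nat) \<in> UNIV}"
  \<comment> \<open>The value is read off an arbitrary representation of \<open>x\<close>;
    \<open>wd'\<close> makes it independent of the choice.\<close>
  define \<chi>' where "\<chi>' x = (let p = (SOME p. fst p \<in> K \<and> x = fst p \<otimes> y [^] (snd p :: nat))
    in \<chi> (fst p) * z ^ snd p)" for x
  have val: "\<chi>' (k \<otimes> y [^] j) = \<chi> k * z ^ j" if k: "k \<in> K" for k and j :: nat
  proof -
    let ?P = "\<lambda>p. fst p \<in> K \<and> k \<otimes> y [^] j = fst p \<otimes> y [^] (snd p :: nat)"
    have "?P (SOME p. ?P p)" by (rule someI[of ?P "(k, j)"]) (use k in simp)
    thus ?thesis unfolding \<chi>'_def Let_def by (intro wd') (use k in auto)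
  qed
  have mult: "(k \<otimes> y [^] i) \<otimes> (l \<otimes> y [^] j) = (k \<otimes> l) \<otimes> y [^] (i + j)"
    if "k \<in> K" "l \<in> K" for k l and i j :: nat
    using that Kc y by (simp add: nat_pow_mult[symmetric] m_ac)
  have mem: "k \<otimes> y [^] j \<in> K'" if "k \<in> K" for k and j :: nat
    unfolding K'_def using that by blast
  have elim: "\<exists>k j. k \<in> K \<and> x = k \<otimes> y [^] (j::nat)" if "x \<in> K'" for x
    using that unfolding K'_def by blast
  have "subgroup K' G"
  proof (rule subgroupI)
    show "K' \<subseteq> carrier G" unfolding K'_def using Kc y by auto
    show "K' \<noteq> {}" using mem[OF subgroup.one_closed[OF K]] by blast
    show "u \<otimes> v \<in> K'" if uv: "u \<in> K'" "v \<in> K'" for u v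
    proof -
      obtain k l and i j :: nat where "k \<in> K" "l \<in> K" "u = k \<otimes> y [^] i" "v = l \<otimes> y [^] j"
        using elim uv by blast
      thus ?thesis using mult mem K by (simp add: subgroup.m_closed)
    qed
    show "inv u \<in> K'" if "u \<in> K'" for u
    proof -
      obtain k and i :: nat where u: "k \<in> K" "u = k \<otimes> y [^] i" using elim \<open>u \<in> K'\<close> by blast
      have o: "order G > 0" using fin order_gt_0_iff_finite by blast
      \<comment> \<open>Elements of \<open>K'\<close> use natural exponents only; finiteness of the
        group provides inverses in this form.\<close>
      have "y [^] (i * (order G - 1)) \<otimes> y [^] i = (y [^] order G) [^] i"
        using y o by (simp add: nat_pow_mult nat_pow_pow algebra_simps diff_mult_distrib2)
      hence "inv (y [^] i) = y [^] (i * (order G - 1))"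
        using y pow_order_eq_1[OF y] by (intro inv_equality) auto
      hence "inv u = inv k \<otimes> y [^] (i * (order G - 1))" using u Kc y by (simp add: inv_mult)
      thus ?thesis using mem K u by (simp add: subgroup.m_inv_closed)
    qed
  qed
  moreover have "k \<in> K'" if "k \<in> K" for k using mem[OF that, of 0] Kc that by simp
  moreover have "y \<in> K'" using mem[OF subgroup.one_closed[OF K], of 1] y by simp
  moreover have "character_on G K' \<chi>'"
    unfolding character_on_def
  proof (intro conjI ballI)
    fix u v assume "u \<in> K'" "v \<in> K'"
    then obtain k l and i j :: nat where "k \<in> K" "l \<in> K" "u = k \<otimes> y [^] i" "v = l \<otimes> y [^] j"
      using elim by blast
    thus "\<chi>' (u \<otimes> v) = \<chi>' u * \<chi>' v"
      using K by (simp add: mult val subgroup.m_closed hom power_add)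
  next
    fix u assume "u \<in> K'"
    then obtain k and i :: nat where "k \<in> K" "u = k \<otimes> y [^] i" using elim by blast
    thus "\<chi>' u \<noteq> 0" using nz z0 by (simp add: val)
  qed
  moreover have "\<chi>' k = \<chi> k" if "k \<in> K" for k using val[OF that, of 0] Kc that by simp
  moreover have "\<chi>' y = z" using val[OF subgroup.one_closed[OF K], of 1] y one by simp
  ultimately show ?thesis using that by blast
qed

lemma least_pow_in_subgroup:
  assumes fin: "finite (carrier G)" and K: "subgroup K G" and y: "y \<in> carrier G"
  obtains m :: nat where "m > 0" "y [^] m \<in> K" "\<And>j. 0 < j \<Longrightarrow> j < m \<Longrightarrow> y [^] j \<notin> K"
proof -
  have "0 < order G \<and> y [^] order G \<in> K"
    using fin K y by (simp add: order_gt_0_iff_finite pow_order_eq_1 subgroup.one_closed)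
  hence "\<exists>m::nat. 0 < m \<and> y [^] m \<in> K" by blast
  from LeastI_ex[OF this] not_less_Least[of _ "\<lambda>m. 0 < m \<and> y [^] m \<in> K"] that show ?thesis by blast
qed

text \<open>Among the subgroups containing \<open>x\<close> that carry a character nontrivial at
  \<open>x\<close>, a maximal one is the whole group, since such a character extends past any
  further element.\<close>

lemma separating_character:
  assumes fin: "finite (carrier G)" and x: "x \<in> carrier G" "x \<noteq> \<one>"
  obtains \<chi> where "character_on G (carrier G) \<chi>" "\<chi> x \<noteq> 1"
proof -
  let ?F = "{K. subgroup K G \<and> x \<in> K \<and> (\<exists>\<chi>. character_on G K \<chi> \<and> \<chi> x \<noteq> 1)}"
  have "?F \<subseteq> Pow (carrier G)" using subgroup.subset by auto
  hence finF: "finite ?F" using fin by (meson finite_Pow_iff finite_subset)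
  have triv: "subgroup {\<one>} G" by (rule triv_subgroup)
  have triv_char: "character_on G {\<one>} (\<lambda>_. 1)" by (simp add: character_on_def)
  \<comment> \<open>Over the trivial subgroup \<open>m\<close> is the order of \<open>x\<close>, so
    any nontrivial \<open>m\<close>-th root of unity is an admissible value at
    \<open>x\<close>.\<close>
  obtain m :: nat where m: "m > 0" "x [^] m \<in> {\<one>}" "\<And>j. 0 < j \<Longrightarrow> j < m \<Longrightarrow> x [^] j \<notin> {\<one>}"
    using least_pow_in_subgroup[OF fin triv x(1)] by blast
  have "m \<noteq> 1" using m(2) x by auto
  hence "m > 1" using m(1) by simp
  then obtain z :: complex where z: "z ^ m = 1" "z \<noteq> 1" by (rule nontrivial_root_of_unity_exists)
  obtain K0 \<chi>0 where "subgroup K0 G" "x \<in> K0" "character_on G K0 \<chi>0" "\<chi>0 x = z"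
    using extend_character[OF fin triv triv_char x(1) m z(1)] by metis
  hence "?F \<noteq> {}" using z(2) by blast
  from finite_has_maximal[OF finF this] obtain K where
    "K \<in> ?F" and max: "\<And>K'. K' \<in> ?F \<Longrightarrow> K \<subseteq> K' \<Longrightarrow> K = K'" by blast
  then obtain \<chi> where K: "subgroup K G" "x \<in> K" "character_on G K \<chi>" "\<chi> x \<noteq> 1" by blast
  have "carrier G \<subseteq> K"
  proof
    fix y assume y: "y \<in> carrier G"
    obtain m :: nat where m: "m > 0" "y [^] m \<in> K" "\<And>j. 0 < j \<Longrightarrow> j < m \<Longrightarrow> y [^] j \<notin> K"
      using least_pow_in_subgroup[OF fin K(1) y] by blast
    obtain z where "z ^ m = \<chi> (y [^] m)" using complex_root_exists[OF m(1)] by blast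
    from extend_character[OF fin K(1,3) y m this] obtain K' \<chi>' where
      "subgroup K' G" "K \<subseteq> K'" "y \<in> K'" "character_on G K' \<chi>'" "\<And>x. x \<in> K \<Longrightarrow> \<chi>' x = \<chi> x"
      by metis
    moreover from this have "\<chi>' x \<noteq> 1" using K by simp
    ultimately have "K' \<in> ?F" using K by blast
    thus "y \<in> K" using max \<open>K \<subseteq> K'\<close> \<open>y \<in> K'\<close> by blast
  qed
  hence "K = carrier G" using K(1) subgroup.subset by blast
  thus ?thesis using that K by blast
qed

end

text \<open>The value 0 off the carrier gives each character a single representative among total
  functions; the unit is the indicator of the carrier.\<close>

definition character_group :: "('a, 'b) monoid_scheme \<Rightarrow> ('a \<Rightarrow> complex) monoid" where
  "character_group G = \<lparr>carrier = {\<chi>. character_on G (carrier G) \<chi> \<and> (\<forall>x. x \<notin> carrier G \<longrightarrow> \<chi> x = 0)},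
     monoid.mult = (\<lambda>\<chi> \<phi> x. \<chi> x * \<phi> x), monoid.one = (\<lambda>x. of_bool (x \<in> carrier G))\<rparr>"

lemma (in comm_group) comm_group_character_group: "comm_group (character_group G)"
proof (rule comm_groupI)
  fix \<chi> assume \<chi>: "\<chi> \<in> carrier (character_group G)"
  let ?\<phi> = "\<lambda>x. inverse (\<chi> x)"
  have "?\<phi> \<in> carrier (character_group G)" using \<chi>
    by (auto simp: character_group_def character_on_def)
  moreover have "?\<phi> \<otimes>\<^bsub>character_group G\<^esub> \<chi> = \<one>\<^bsub>character_group G\<^esub>"
    using \<chi> by (auto simp: character_group_def character_on_def)
  ultimately show "\<exists>\<phi>\<in>carrier (character_group G). \<phi> \<otimes>\<^bsub>character_group G\<^esub> \<chi> = \<one>\<^bsub>character_group G\<^esub>"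
    by blast
qed (auto simp: character_group_def character_on_def fun_eq_iff)

lemma (in comm_group) dual_pair_character_group:
  assumes fin: "finite (carrier G)"
  shows "dual_pair G (character_group G) (\<lambda>x \<chi>. \<chi> x)"
proof -
  let ?C = "character_group G"
  interpret C: comm_group ?C by (rule comm_group_character_group)
  have o: "order G > 0" using fin order_gt_0_iff_finite by blast
  \<comment> \<open>Nonvanishing multiplicative functions take values in the
    \<open>order G\<close>-th roots of unity, so there are finitely many of them.\<close>
  have sub: "carrier ?C \<subseteq> {\<chi>. \<forall>x. (x \<in> carrier G \<longrightarrow> \<chi> x \<in> {z. z ^ order G = 1}) \<and> (x \<notin> carrier G \<longrightarrow> \<chi> x = 0)}"
  proof (clarify, intro conjI impI)
    fix \<chi> x assume \<chi>: "\<chi> \<in> carrier ?C"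
    show "\<chi> x = 0" if "x \<notin> carrier G" using \<chi> that by (simp add: character_group_def)
    assume x: "x \<in> carrier G"
    have c: "character_on G (carrier G) \<chi>" using \<chi> by (simp add: character_group_def)
    have "\<chi> x ^ order G = \<chi> (x [^] order G)" using character_on_pow[OF subgroup_self c x] by simp
    thus "\<chi> x \<in> {z. z ^ order G = 1}"
      using x character_on_one[OF subgroup_self c] by (simp add: pow_order_eq_1)
  qed
  have "finite {z::complex. z ^ order G = 1}" using o by (intro finite_roots_unity) auto
  hence finC: "finite (carrier ?C)" 
    by (intro finite_subset[OF sub] finite_set_of_finite_funs fin)
  show ?thesis
  proof
    show "finite (carrier G)" by (rule fin)
    show "finite (carrier ?C)" by (rule finC)
    show "\<exists>\<chi>\<in>carrier ?C. \<chi> x \<noteq> 1" if x: "x \<in> carrier G" "x \<noteq> \<one>" for x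
    proof -
      obtain \<chi> where \<chi>: "character_on G (carrier G) \<chi>" "\<chi> x \<noteq> 1"
        using separating_character[OF fin x] by blast
      have "(\<lambda>y. if y \<in> carrier G then \<chi> y else 0) \<in> carrier ?C"
        using \<chi>(1) by (auto simp: character_group_def character_on_def)
      thus ?thesis using \<chi>(2) x by (intro bexI[of _ "\<lambda>y. if y \<in> carrier G then \<chi> y else 0"]) simp_all
    qed
    show "\<exists>x\<in>carrier G. \<chi> x \<noteq> 1" if \<chi>: "\<chi> \<in> carrier ?C" "\<chi> \<noteq> \<one>\<^bsub>?C\<^esub>" for \<chi>
    proof (rule ccontr)
      assume "\<not> (\<exists>x\<in>carrier G. \<chi> x \<noteq> 1)"
      hence "\<chi> = \<one>\<^bsub>?C\<^esub>" using \<chi>(1) by (auto simp: character_group_def)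
      thus False using \<chi>(2) by simp
    qed
  qed (auto simp: character_group_def character_on_def)
qed

section \<open>Sets with two character values\<close>

text \<open>\<open>S\<close> stands for the difference set and \<open>T\<close> for the nontrivial
  characters whose sum over it is \<open>eps * (a * b - r)\<close>. The locale is later instantiated
  twice, the second time with the two sets exchanged.\<close>

locale pds_pair = dual_pair A B w
  for A :: "('a, 'm) monoid_scheme" and B :: "('b, 'n) monoid_scheme" and w +
  fixes a b :: nat and r eps :: int and S :: "'a set" and T :: "'b set"
  assumes order_A: "order A = a\<^sup>2 * b\<^sup>2"
    and a_pos: "a > 0" and coprime_ab: "coprime a b" and odd_b: "odd b"
    and eps: "eps = 1 \<or> eps = -1"
    and S_subset: "S \<subseteq> carrier A - {\<one>\<^bsub>A\<^esub>}" and T_subset: "T \<subseteq> carrier B - {\<one>\<^bsub>B\<^esub>}"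
    and S_inv: "x \<in> S \<Longrightarrow> inv\<^bsub>A\<^esub> x \<in> S"
    and T_pow: "\<lbrakk>coprime s (a * b); c \<in> T\<rbrakk> \<Longrightarrow> c [^]\<^bsub>B\<^esub> (s::nat) \<in> T"
    and sum_S: "\<lbrakk>c \<in> carrier B; c \<noteq> \<one>\<^bsub>B\<^esub>\<rbrakk> \<Longrightarrow>
      (\<Sum>x\<in>S. w x c) = of_int (eps * (int a * int b * of_bool (c \<in> T) - r))"
    and card_S: "int (card S) = r * (int a * int b - eps)"
begin

lemma order_B: "order B = a\<^sup>2 * b\<^sup>2"
  using order_A order_eq by simp

lemma b_pos: "b > 0"
  using odd_b by (cases b) auto

lemma coprime_squares: "coprime (a\<^sup>2) (b\<^sup>2)"
  using coprime_ab by simp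

section \<open>Orthogonality on the torsion parts\<close>

abbreviation "NA \<equiv> torsion A (a\<^sup>2)"
abbreviation "NB \<equiv> torsion B (a\<^sup>2)"
abbreviation "HB \<equiv> torsion B (b\<^sup>2)"

lemma card_NB: "card NB = a\<^sup>2" and card_HB: "card HB = b\<^sup>2"
  using B.card_torsion[OF finite_B order_B coprime_squares]
    B.card_torsion[OF finite_B, of "b\<^sup>2" "a\<^sup>2"] order_B coprime_squares
  by (simp_all add: mult.commute coprime_commute)

lemma finite_sets: "finite S" "finite T" "finite NA" "finite NB" "finite HB"
  using S_subset T_subset finite_A finite_B
  by (auto simp: torsion_def intro: finite_subset)

lemma carriers:
  "x \<in> S \<Longrightarrow> x \<in> carrier A" "x \<in> NA \<Longrightarrow> x \<in> carrier A" "c \<in> T \<Longrightarrow> c \<in> carrier B"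
  "c \<in> NB \<Longrightarrow> c \<in> carrier B" "c \<in> HB \<Longrightarrow> c \<in> carrier B"
  using S_subset T_subset by (auto simp: torsion_def)

text \<open>\<open>HB\<close> is the annihilator of \<open>NA\<close>: on \<open>NA\<close> its
  values are roots of unity of two coprime orders. For \<open>x\<close> outside \<open>NA\<close>, a
  character nontrivial at the \<open>a\<^sup>2\<close>-th power of \<open>x\<close> has its own
  \<open>a\<^sup>2\<close>-th power in \<open>HB\<close>, nontrivial at \<open>x\<close>.\<close>

lemma sum_HB:
  assumes x: "x \<in> carrier A"
  shows "(\<Sum>c\<in>HB. w x c) = of_nat (b\<^sup>2) * of_bool (x \<in> NA)"
proof (cases "x \<in> NA")
  case True
  have "w x c = 1" if "c \<in> HB" for c
  proof (rule power_coprime_eq_1[OF _ _ coprime_squares])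
    show "w x c ^ a\<^sup>2 = 1" using True that by (simp add: torsion_def one_left flip: pow_left)
    show "w x c ^ b\<^sup>2 = 1" using that x by (simp add: torsion_def one_right flip: pow_right)
  qed (use a_pos in simp)
  thus ?thesis using True by (simp add: card_HB)
next
  case False
  then obtain c where c: "c \<in> carrier B" "w (x [^]\<^bsub>A\<^esub> a\<^sup>2) c \<noteq> 1"
    using nondeg_left[of "x [^]\<^bsub>A\<^esub> a\<^sup>2"] x by (auto simp: torsion_def)
  hence "w x (c [^]\<^bsub>B\<^esub> a\<^sup>2) \<noteq> 1" using x by (simp add: pow_left pow_right)
  moreover have "c [^]\<^bsub>B\<^esub> a\<^sup>2 \<in> HB"
    using c B.pow_order_eq_1[of c] by (simp add: torsion_def B.nat_pow_pow order_B)
  ultimately have "(\<Sum>c\<in>HB. w x c) = 0"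
    using B.sum_nontrivial_hom_eq_0[OF B.torsion_subgroup, of "b\<^sup>2" "w x"] x
    by (simp add: mult_right carriers)
  thus ?thesis using False by simp
qed

text \<open>\<open>NB\<close> separates the points of \<open>NA\<close>: the
  \<open>b\<^sup>2\<close>-th power of a nontrivial \<open>x\<close> stays nontrivial, and the
  exponent can be moved onto the character, which then lies in \<open>NB\<close>.\<close>

lemma sum_NB:
  assumes x: "x \<in> NA"
  shows "(\<Sum>c\<in>NB. w x c) = of_nat (a\<^sup>2) * of_bool (x = \<one>\<^bsub>A\<^esub>)"
proof (cases "x = \<one>\<^bsub>A\<^esub>")
  case True
  thus ?thesis by (simp add: one_left carriers card_NB)
next
  case False
  have xc: "x \<in> carrier A" using x carriers by blast
  hence "x [^]\<^bsub>A\<^esub> b\<^sup>2 \<noteq> \<one>\<^bsub>A\<^esub>"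
    using False x A.pow_coprime_eq_one[OF xc _ _ coprime_squares] by (auto simp: torsion_def)
  then obtain c where c: "c \<in> carrier B" "w (x [^]\<^bsub>A\<^esub> b\<^sup>2) c \<noteq> 1"
    using nondeg_left[of "x [^]\<^bsub>A\<^esub> b\<^sup>2"] xc by auto
  hence "w x (c [^]\<^bsub>B\<^esub> b\<^sup>2) \<noteq> 1" using xc by (simp add: pow_left pow_right)
  moreover have "c [^]\<^bsub>B\<^esub> b\<^sup>2 \<in> NB"
    using c B.pow_order_eq_1[of c] by (simp add: torsion_def B.nat_pow_pow order_B mult.commute)
  ultimately have "(\<Sum>c\<in>NB. w x c) = 0"
    using B.sum_nontrivial_hom_eq_0[OF B.torsion_subgroup, of "a\<^sup>2" "w x"] xc
    by (simp add: mult_right carriers)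
  thus ?thesis using False by simp
qed

section \<open>Character values on the torsion part\<close>

definition eig :: "'b \<Rightarrow> complex" where "eig c = (\<Sum>x\<in>S \<inter> NA. w x c)"

text \<open>For \<open>c\<close> in \<open>NB\<close>, multiplying by \<open>HB\<close> runs through
  the characters that agree with \<open>c\<close> on \<open>NA\<close>; the fibre indexes those
  lying in \<open>T\<close>.\<close>

definition fibre :: "'b \<Rightarrow> 'b set" where "fibre c = {d \<in> HB. c \<otimes>\<^bsub>B\<^esub> d \<in> T}"

text \<open>By \<open>sum_HB\<close>, summing over \<open>HB\<close> filters \<open>S\<close> down
  to \<open>NA\<close>, with a factor \<open>b\<^sup>2\<close>.\<close>

lemma eig_fourier:
  assumes c: "c \<in> NB"
  shows "of_nat (b\<^sup>2) * eig c = (\<Sum>d\<in>HB. \<Sum>x\<in>S. w x (c \<otimes>\<^bsub>B\<^esub> d))"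
proof -
  have "(\<Sum>d\<in>HB. \<Sum>x\<in>S. w x (c \<otimes>\<^bsub>B\<^esub> d)) = (\<Sum>d\<in>HB. \<Sum>x\<in>S. w x c * w x d)"
    using c by (intro sum.cong refl) (simp add: mult_right carriers)
  also have "\<dots> = (\<Sum>x\<in>S. w x c * (\<Sum>d\<in>HB. w x d))"
    by (subst sum.swap) (simp add: sum_distrib_left)
  also have "\<dots> = (\<Sum>x\<in>S. if x \<in> NA then w x c * of_nat (b\<^sup>2) else 0)"
    by (intro sum.cong refl) (simp add: sum_HB carriers)
  also have "\<dots> = of_nat (b\<^sup>2) * eig c"
    unfolding eig_def sum_distrib_left
    by (simp add: sum.inter_restrict[OF finite_sets(1), symmetric] mult.commute)
  finally show ?thesis by simp
qed

text \<open>\<open>NB\<close> and \<open>HB\<close> meet trivially, so none of the characters in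
  \<open>eig_fourier\<close> is trivial and \<open>sum_S\<close> applies to each.\<close>

lemma eig_eq_card_fibre:
  assumes c: "c \<in> NB" "c \<noteq> \<one>\<^bsub>B\<^esub>"
  shows "of_nat (b\<^sup>2) * eig c = of_int (eps * (int a * int b * int (card (fibre c)) - r * int (b\<^sup>2)))"
proof -
  have ne: "c \<otimes>\<^bsub>B\<^esub> d \<noteq> \<one>\<^bsub>B\<^esub>" if d: "d \<in> HB" for d
  proof
    assume "c \<otimes>\<^bsub>B\<^esub> d = \<one>\<^bsub>B\<^esub>"
    hence "c = inv\<^bsub>B\<^esub> d" using c d by (metis B.inv_equality carriers(4,5))
    hence "c \<in> HB" using d B.torsion_subgroup by (simp add: subgroup.m_inv_closed)
    thus False using B.torsion_Int_torsion[OF coprime_squares c(1)] c(2) by simp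
  qed
  have "of_nat (b\<^sup>2) * eig c =
      (\<Sum>d\<in>HB. of_int (eps * (int a * int b * of_bool (c \<otimes>\<^bsub>B\<^esub> d \<in> T) - r)))"
    unfolding eig_fourier[OF c(1)]
    by (intro sum.cong refl sum_S) (use c ne carriers in auto)
  also have "\<dots> = of_int (\<Sum>d\<in>HB. eps * (int a * int b * of_bool (c \<otimes>\<^bsub>B\<^esub> d \<in> T) - r))"
    by simp
  also have "(\<Sum>d\<in>HB. eps * (int a * int b * of_bool (c \<otimes>\<^bsub>B\<^esub> d \<in> T) - r)) =
      eps * (int a * int b * (\<Sum>d\<in>HB. of_bool (c \<otimes>\<^bsub>B\<^esub> d \<in> T)) - r * int (b\<^sup>2))"
    by (simp add: sum_subtractf card_HB right_diff_distrib flip: sum_distrib_left)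
  also have "(\<Sum>d\<in>HB. of_bool (c \<otimes>\<^bsub>B\<^esub> d \<in> T)) = int (card (fibre c))"
    unfolding fibre_def by (simp add: of_bool_def finite_sets sum.If_cases Int_def)
  finally show ?thesis .
qed

text \<open>This is \<open>eig_fourier\<close> at the identity, whose own term is
  \<open>card S\<close>. It later converts the size of the \<open>NA\<close>-part of
  \<open>S\<close> into that of the \<open>HB\<close>-part of \<open>T\<close>.\<close>

lemma card_torsion_S:
  "int b * int (card (S \<inter> NA)) = r * int a + eps * (int a * int (card (T \<inter> HB)) - r * int b)"
proof -
  have one: "\<one>\<^bsub>B\<^esub> \<in> HB" "\<one>\<^bsub>B\<^esub> \<in> NB" by (simp_all add: torsion_def)
  have "eig \<one>\<^bsub>B\<^esub> = of_nat (card (S \<inter> NA))"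
    unfolding eig_def by (simp add: one_right carriers)
  hence "of_nat (b\<^sup>2) * of_nat (card (S \<inter> NA)) = (\<Sum>d\<in>HB. \<Sum>x\<in>S. w x d)"
    using eig_fourier[OF one(2)] carriers by simp
  also have "\<dots> = (\<Sum>x\<in>S. w x \<one>\<^bsub>B\<^esub>) + (\<Sum>d\<in>HB - {\<one>\<^bsub>B\<^esub>}. \<Sum>x\<in>S. w x d)"
    by (rule sum.remove[OF finite_sets(5) one(1)])
  also have "(\<Sum>x\<in>S. w x \<one>\<^bsub>B\<^esub>) = of_int (r * (int a * int b - eps))"
    unfolding card_S[symmetric] by (simp add: one_right carriers)
  also have "(\<Sum>d\<in>HB - {\<one>\<^bsub>B\<^esub>}. \<Sum>x\<in>S. w x d) =
      (\<Sum>d\<in>HB - {\<one>\<^bsub>B\<^esub>}. of_int (eps * (int a * int b * of_bool (d \<in> T) - r)))"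
    by (intro sum.cong refl sum_S) (auto simp: carriers)
  also have "\<dots> = of_int (\<Sum>d\<in>HB - {\<one>\<^bsub>B\<^esub>}. eps * (int a * int b * of_bool (d \<in> T) - r))"
    by simp
  also have "(\<Sum>d\<in>HB - {\<one>\<^bsub>B\<^esub>}. eps * (int a * int b * of_bool (d \<in> T) - r)) =
      eps * (int a * int b * (\<Sum>d\<in>HB - {\<one>\<^bsub>B\<^esub>}. of_bool (d \<in> T)) - r * int (b\<^sup>2 - 1))"
    using one by (simp add: sum_subtractf card_HB right_diff_distrib flip: sum_distrib_left)
  also have "(\<Sum>d\<in>HB - {\<one>\<^bsub>B\<^esub>}. of_bool (d \<in> T)) = int (card (T \<inter> HB))"
  proof -
    have "(HB - {\<one>\<^bsub>B\<^esub>}) \<inter> T = T \<inter> HB" using T_subset by auto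
    thus ?thesis by (simp add: of_bool_def finite_sets sum.If_cases Int_def conj_commute)
  qed
  finally have "complex_of_int (int (b\<^sup>2) * int (card (S \<inter> NA))) =
      of_int (r * (int a * int b - eps) + eps * (int a * int b * int (card (T \<inter> HB)) - r * int (b\<^sup>2 - 1)))"
    by simp
  hence "int (b\<^sup>2) * int (card (S \<inter> NA)) =
      r * (int a * int b - eps) + eps * (int a * int b * int (card (T \<inter> HB)) - r * int (b\<^sup>2 - 1))"
    by (simp only: of_int_eq_iff)
  moreover have "int (b\<^sup>2 - 1) = (int b)\<^sup>2 - 1" using b_pos by (simp add: of_nat_diff)
  ultimately have "(int b)\<^sup>2 * int (card (S \<inter> NA)) =
      r * (int a * int b - eps) + eps * (int a * int b * int (card (T \<inter> HB)) - r * ((int b)\<^sup>2 - 1))"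
    by simp
  hence "int b * (int b * int (card (S \<inter> NA))) =
      int b * (r * int a + eps * (int a * int (card (T \<inter> HB)) - r * int b))"
    unfolding power2_eq_square[of "int b"] by (simp add: algebra_simps)
  thus ?thesis using b_pos by simp
qed

text \<open>The values of \<open>c\<close> on \<open>NA\<close> form an eigenvector, with eigenvalue
  \<open>eig c\<close>, of the 0/1 Cayley matrix of \<open>S\<close> on \<open>NA\<close>;
  rationality comes from \<open>eig_eq_card_fibre\<close>.\<close>

lemma eig_Ints:
  assumes c: "c \<in> NB" "c \<noteq> \<one>\<^bsub>B\<^esub>"
  shows "eig c \<in> \<int>"
proof (rule rational_eigenvalue_of_int_matrix[where u = "\<lambda>x. w x c"
      and M = "\<lambda>x y. of_bool (inv\<^bsub>A\<^esub> x \<otimes>\<^bsub>A\<^esub> y \<in> S)"])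
  have "eig c = of_int (eps * (int a * int b * int (card (fibre c)) - r * int (b\<^sup>2))) / of_nat (b\<^sup>2)"
    using eig_eq_card_fibre[OF c] b_pos by (simp add: field_simps)
  thus "eig c \<in> \<rat>" by simp
  show "finite NA" by (rule finite_sets)
  show "\<one>\<^bsub>A\<^esub> \<in> NA" by (simp add: torsion_def)
  show "w \<one>\<^bsub>A\<^esub> c \<noteq> 0" using c by (simp add: one_left carriers)
  fix x assume x: "x \<in> NA"
  have bij: "bij_betw (\<lambda>y. x \<otimes>\<^bsub>A\<^esub> y) NA NA"
  proof (rule bij_betw_byWitness[where f' = "\<lambda>y. inv\<^bsub>A\<^esub> x \<otimes>\<^bsub>A\<^esub> y"])
    show "\<forall>y\<in>NA. inv\<^bsub>A\<^esub> x \<otimes>\<^bsub>A\<^esub> (x \<otimes>\<^bsub>A\<^esub> y) = y" "\<forall>y\<in>NA. x \<otimes>\<^bsub>A\<^esub> (inv\<^bsub>A\<^esub> x \<otimes>\<^bsub>A\<^esub> y) = y"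
      using x by (auto simp: carriers A.m_assoc[symmetric])
  qed (use A.torsion_subgroup x in \<open>auto simp: subgroup.m_closed subgroup.m_inv_closed\<close>)
  have "(\<Sum>y\<in>NA. of_int (of_bool (inv\<^bsub>A\<^esub> x \<otimes>\<^bsub>A\<^esub> y \<in> S)) * w y c) =
      (\<Sum>y\<in>NA. of_int (of_bool (inv\<^bsub>A\<^esub> x \<otimes>\<^bsub>A\<^esub> (x \<otimes>\<^bsub>A\<^esub> y) \<in> S)) * w (x \<otimes>\<^bsub>A\<^esub> y) c)"
    using sum.reindex_bij_betw[OF bij, symmetric] by blast
  also have "\<dots> = (\<Sum>y\<in>NA. if y \<in> S then w y c * w x c else 0)"
    using x c by (intro sum.cong refl) (simp add: carriers mult_left A.m_assoc[symmetric])
  also have "\<dots> = eig c * w x c"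
    unfolding eig_def sum_distrib_right
    by (simp add: sum.inter_restrict[OF finite_sets(3), symmetric] Int_commute)
  finally show "(\<Sum>y\<in>NA. of_int (of_bool (inv\<^bsub>A\<^esub> x \<otimes>\<^bsub>A\<^esub> y \<in> S)) * w y c) = eig c * w x c" .
qed

text \<open>A power that is 1 modulo \<open>a\<^sup>2\<close> and -1 modulo \<open>b\<^sup>2\<close>
  preserves \<open>T\<close>, fixes \<open>c\<close> and inverts \<open>HB\<close>, so inversion
  acts on the fibre. As \<open>HB\<close> has odd order, only the identity can be fixed, and it lies
  in the fibre exactly when \<open>c\<close> is in \<open>T\<close>.\<close>

lemma fibre_parity:
  assumes c: "c \<in> NB"
  shows "odd (card (fibre c)) \<longleftrightarrow> c \<in> T"
proof -
  obtain s where s: "[s = 1] (mod a\<^sup>2)" "[s = b\<^sup>2 - 1] (mod b\<^sup>2)"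
    using binary_chinese_remainder_nat[OF coprime_squares] by blast
  have "coprime (b\<^sup>2 - 1) (b\<^sup>2)" using coprime_diff_one_left_nat[of "b\<^sup>2"] b_pos by simp
  hence "coprime s (b\<^sup>2)" using s(2) by (metis cong_imp_coprime cong_sym)
  moreover have "coprime s (a\<^sup>2)" using s(1) by (metis cong_imp_coprime cong_sym coprime_1_left)
  ultimately have s_cop: "coprime s (a * b)" by simp
  have closed: "inv\<^bsub>B\<^esub> d \<in> fibre c" if d: "d \<in> fibre c" for d
  proof -
    have dH: "d \<in> HB" and T: "c \<otimes>\<^bsub>B\<^esub> d \<in> T" using d by (auto simp: fibre_def)
    have car: "c \<in> carrier B" "d \<in> carrier B" using c dH carriers by auto
    have "c [^]\<^bsub>B\<^esub> s = c [^]\<^bsub>B\<^esub> (1::nat)"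
      using s(1) c by (intro B.nat_pow_cong) (auto simp: torsion_def)
    hence "c [^]\<^bsub>B\<^esub> s = c" using car by simp
    moreover have "d [^]\<^bsub>B\<^esub> s = inv\<^bsub>B\<^esub> d"
    proof -
      have "d [^]\<^bsub>B\<^esub> s = d [^]\<^bsub>B\<^esub> (b\<^sup>2 - 1)"
        using s(2) dH by (intro B.nat_pow_cong) (auto simp: torsion_def)
      moreover have "d [^]\<^bsub>B\<^esub> (b\<^sup>2 - 1) \<otimes>\<^bsub>B\<^esub> d = \<one>\<^bsub>B\<^esub>"
        using dH b_pos by (simp add: torsion_def flip: B.nat_pow_Suc)
      ultimately show ?thesis using car by (metis B.inv_equality B.nat_pow_closed)
    qed
    ultimately have "(c \<otimes>\<^bsub>B\<^esub> d) [^]\<^bsub>B\<^esub> s = c \<otimes>\<^bsub>B\<^esub> inv\<^bsub>B\<^esub> d"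
      using car by (simp add: B.nat_pow_distrib)
    hence "c \<otimes>\<^bsub>B\<^esub> inv\<^bsub>B\<^esub> d \<in> T" using T_pow[OF s_cop T] by simp
    thus ?thesis using dH B.torsion_subgroup by (simp add: fibre_def subgroup.m_inv_closed)
  qed
  have car: "d \<in> carrier B" if "d \<in> fibre c" for d using that carriers by (auto simp: fibre_def)
  have fin: "finite (fibre c)" using finite_sets by (simp add: fibre_def)
  have "[card (fibre c) = card {d \<in> fibre c. inv\<^bsub>B\<^esub> d = d}] (mod 2)"
    by (rule card_cong_card_fixpoints[OF two_is_prime_nat fin])
      (use closed car in \<open>auto simp: numeral_2_eq_2\<close>)
  moreover have "{d \<in> fibre c. inv\<^bsub>B\<^esub> d = d} = (if c \<in> T then {\<one>\<^bsub>B\<^esub>} else {})"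
  proof -
    have "d = \<one>\<^bsub>B\<^esub>" if "d \<in> fibre c" "inv\<^bsub>B\<^esub> d = d" for d
    proof (rule B.pow_coprime_eq_one)
      show "d \<in> carrier B" using car that by simp
      thus "d [^]\<^bsub>B\<^esub> (2::nat) = \<one>\<^bsub>B\<^esub>" using that(2) B.r_inv[of d] by (simp add: numeral_2_eq_2)
      show "d [^]\<^bsub>B\<^esub> b\<^sup>2 = \<one>\<^bsub>B\<^esub>" using that by (simp add: fibre_def torsion_def)
      show "coprime 2 (b\<^sup>2)" using odd_b by simp
    qed
    moreover have "\<one>\<^bsub>B\<^esub> \<in> fibre c \<longleftrightarrow> c \<in> T"
      using c by (simp add: fibre_def torsion_def)
    moreover have "inv\<^bsub>B\<^esub> \<one>\<^bsub>B\<^esub> = \<one>\<^bsub>B\<^esub>" by simp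
    ultimately have "d \<in> fibre c \<and> inv\<^bsub>B\<^esub> d = d \<longleftrightarrow> c \<in> T \<and> d = \<one>\<^bsub>B\<^esub>" for d by metis
    thus ?thesis by simp
  qed
  ultimately have "[card (fibre c) = of_bool (c \<in> T)] (mod 2)" by (cases "c \<in> T") auto
  thus ?thesis by (auto simp: cong_def odd_iff_mod_2_eq_one split: if_splits)
qed

text \<open>Integrality of \<open>eig c\<close> makes \<open>b\<close> divide
  \<open>a * card (fibre c)\<close>, hence the fibre size. The quotient is \<open>m\<close>, of the
  same parity because \<open>b\<close> is odd.\<close>

lemma eig_form:
  assumes c: "c \<in> NB" "c \<noteq> \<one>\<^bsub>B\<^esub>"
  obtains m :: int where "eig c = of_int (eps * (int a * m - r))" "odd m \<longleftrightarrow> c \<in> T"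
proof -
  obtain z where z: "eig c = of_int z" using eig_Ints[OF c] by (auto elim: Ints_cases)
  let ?m = "int (card (fibre c))"
  have "complex_of_int (int (b\<^sup>2) * z) = of_int (eps * (int a * int b * ?m - r * int (b\<^sup>2)))"
    using eig_eq_card_fibre[OF c] z by simp
  hence "int (b\<^sup>2) * z = eps * (int a * int b * ?m - r * int (b\<^sup>2))"
    by (simp only: of_int_eq_iff)
  hence "int b * (int b * z) = int b * (eps * (int a * ?m - r * int b))"
    by (simp add: algebra_simps power2_eq_square)
  hence z2: "int b * z = eps * (int a * ?m - r * int b)" using b_pos by simp
  have "int a * ?m = int b * (eps * z + r)" using z2 eps by (auto simp: algebra_simps)
  hence "int b dvd int a * ?m" by simp
  moreover have "coprime (int b) (int a)" using coprime_ab by (simp add: coprime_commute)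
  ultimately have "int b dvd ?m" by (simp add: coprime_dvd_mult_right_iff)
  then obtain m where m: "?m = int b * m" by blast
  hence "int b * z = int b * (eps * (int a * m - r))" using z2 by (simp add: algebra_simps)
  hence "z = eps * (int a * m - r)" using b_pos by simp
  moreover have "odd m \<longleftrightarrow> c \<in> T"
  proof -
    have "odd ?m \<longleftrightarrow> odd m" using odd_b by (simp add: m)
    thus ?thesis using fibre_parity[OF c(1)] by simp
  qed
  ultimately show ?thesis using that z by blast
qed

section \<open>Moments and the parity inequality\<close>

lemma sum_eig: "(\<Sum>c\<in>NB. eig c) = 0"
proof -
  have "(\<Sum>c\<in>NB. eig c) = (\<Sum>x\<in>S \<inter> NA. \<Sum>c\<in>NB. w x c)"
    unfolding eig_def by (rule sum.swap)
  also have "\<dots> = (\<Sum>x\<in>S \<inter> NA. 0)"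
    using S_subset by (intro sum.cong refl) (auto simp: sum_NB)
  finally show ?thesis by simp
qed

text \<open>Orthogonality keeps the pairs with product 1, and inverse-closure of \<open>S\<close>
  gives each \<open>x\<close> exactly one partner, so plain squares suffice.\<close>

lemma sum_eig_squares: "(\<Sum>c\<in>NB. (eig c)\<^sup>2) = of_nat (a\<^sup>2 * card (S \<inter> NA))"
proof -
  have mem: "x \<otimes>\<^bsub>A\<^esub> y \<in> NA" if "x \<in> S \<inter> NA" "y \<in> S \<inter> NA" for x y
    using that A.torsion_subgroup by (auto intro: subgroup.m_closed)
  have one_iff: "x \<otimes>\<^bsub>A\<^esub> y = \<one>\<^bsub>A\<^esub> \<longleftrightarrow> y = inv\<^bsub>A\<^esub> x" if "x \<in> S \<inter> NA" "y \<in> S \<inter> NA" for x y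
    using that carriers by (metis A.inv_comm A.inv_equality A.r_inv IntD1)
  have "(\<Sum>c\<in>NB. (eig c)\<^sup>2) = (\<Sum>c\<in>NB. eig c * eig c)"
    by (simp add: power2_eq_square[of "eig _"])
  also have "\<dots> = (\<Sum>c\<in>NB. \<Sum>x\<in>S \<inter> NA. \<Sum>y\<in>S \<inter> NA. w (x \<otimes>\<^bsub>A\<^esub> y) c)"
    unfolding eig_def sum_product
    by (intro sum.cong refl) (simp add: mult_left carriers)
  also have "\<dots> = (\<Sum>x\<in>S \<inter> NA. \<Sum>y\<in>S \<inter> NA. \<Sum>c\<in>NB. w (x \<otimes>\<^bsub>A\<^esub> y) c)"
    by (subst sum.swap, intro sum.cong refl, rule sum.swap)
  also have "\<dots> = (\<Sum>x\<in>S \<inter> NA. \<Sum>y\<in>S \<inter> NA. if y = inv\<^bsub>A\<^esub> x then of_nat (a\<^sup>2) else 0)"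
    by (intro sum.cong refl) (simp add: sum_NB mem one_iff)
  also have "\<dots> = (\<Sum>x\<in>S \<inter> NA. of_nat (a\<^sup>2))"
    using S_inv A.torsion_subgroup
    by (intro sum.cong refl) (simp add: finite_sets subgroup.m_inv_closed)
  finally show ?thesis by simp
qed

text \<open>The two moments determine the sum of \<open>(m c - v)\<^sup>2\<close> over nontrivial
  \<open>c\<close>. Every odd \<open>m c - v\<close> contributes at least 1, and the parity of
  \<open>v\<close> decides whether these \<open>c\<close> are the members or the nonmembers of
  \<open>T\<close>.\<close>

lemma variance_bound:
  fixes v :: int
  defines "k1 \<equiv> int (card (S \<inter> NA))" and "n1 \<equiv> int (card (T \<inter> NB))" and "d \<equiv> r - int a * v"
  shows "(int a)\<^sup>2 * (if even v then n1 else (int a)\<^sup>2 - 1 - n1)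
    \<le> (int a)\<^sup>2 * k1 - k1\<^sup>2 - 2 * eps * d * k1 + ((int a)\<^sup>2 - 1) * d\<^sup>2"
proof -
  let ?N = "NB - {\<one>\<^bsub>B\<^esub>}"
  have one: "\<one>\<^bsub>B\<^esub> \<in> NB" by (simp add: torsion_def)
  have "\<forall>c\<in>?N. \<exists>m. eig c = of_int (eps * (int a * m - r)) \<and> (odd m \<longleftrightarrow> c \<in> T)"
    using eig_form by (metis DiffE insertI1)
  then obtain m where m: "\<And>c. c \<in> ?N \<Longrightarrow> eig c = of_int (eps * (int a * m c - r))"
    and par: "\<And>c. c \<in> ?N \<Longrightarrow> odd (m c) \<longleftrightarrow> c \<in> T" by metis
  define z where "z c = eps * (int a * m c - r)" for c
  have eig1: "eig \<one>\<^bsub>B\<^esub> = of_int k1"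
    unfolding eig_def k1_def by (simp add: one_right carriers)
  have fin: "finite ?N" using finite_sets by simp
  have cardN: "int (card ?N) = (int a)\<^sup>2 - 1"
    using one a_pos by (simp add: card_NB of_nat_diff)
  have "complex_of_int (k1 + (\<Sum>c\<in>?N. z c)) = of_int 0"
    using sum_eig sum.remove[OF finite_sets(4) one, of eig] m eig1 by (simp add: z_def)
  hence s1: "(\<Sum>c\<in>?N. z c) = - k1" by (simp only: of_int_eq_iff)
  have "complex_of_int (k1\<^sup>2 + (\<Sum>c\<in>?N. (z c)\<^sup>2)) = of_int ((int a)\<^sup>2 * k1)"
    using sum_eig_squares sum.remove[OF finite_sets(4) one, of "\<lambda>c. (eig c)\<^sup>2"] m eig1
    by (simp add: z_def k1_def)
  hence s2: "(\<Sum>c\<in>?N. (z c)\<^sup>2) = (int a)\<^sup>2 * k1 - k1\<^sup>2"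
    by (simp only: of_int_eq_iff)
  \<comment> \<open>The shift of \<open>m c\<close> by \<open>v\<close> becomes a shift of
    \<open>eps * z c\<close> by \<open>d\<close>, so the square expands into the two known
    moments.\<close>
  have zz: "(int a)\<^sup>2 * (m c - v)\<^sup>2 = (z c)\<^sup>2 + 2 * eps * d * z c + d\<^sup>2" for c
  proof -
    have "int a * (m c - v) = eps * z c + d" using eps unfolding z_def d_def by (auto simp: algebra_simps)
    hence "(int a)\<^sup>2 * (m c - v)\<^sup>2 = (eps * z c + d)\<^sup>2" by (metis power_mult_distrib)
    thus ?thesis using eps by (auto simp: power2_eq_square algebra_simps)
  qed
  have "(int a)\<^sup>2 * (\<Sum>c\<in>?N. (m c - v)\<^sup>2) = (\<Sum>c\<in>?N. (z c)\<^sup>2 + 2 * eps * d * z c + d\<^sup>2)"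
    by (simp add: sum_distrib_left zz)
  also have "\<dots> = (\<Sum>c\<in>?N. (z c)\<^sup>2) + 2 * eps * d * (\<Sum>c\<in>?N. z c) + int (card ?N) * d\<^sup>2"
    by (simp add: sum.distrib sum_distrib_left)
  also have "\<dots> = (int a)\<^sup>2 * k1 - k1\<^sup>2 - 2 * eps * d * k1 + ((int a)\<^sup>2 - 1) * d\<^sup>2"
    by (simp add: s1 s2 cardN)
  finally have total: "(int a)\<^sup>2 * (\<Sum>c\<in>?N. (m c - v)\<^sup>2) =
      (int a)\<^sup>2 * k1 - k1\<^sup>2 - 2 * eps * d * k1 + ((int a)\<^sup>2 - 1) * d\<^sup>2" .
  have TN: "T \<inter> NB = {c \<in> ?N. odd (m c)}" using par T_subset by auto
  have "(if even v then n1 else (int a)\<^sup>2 - 1 - n1) = (\<Sum>c\<in>?N. of_bool (odd (m c - v)))"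
  proof (cases "even v")
    case True
    thus ?thesis unfolding n1_def TN using fin by (simp add: of_bool_def sum.If_cases Int_def)
  next
    case False
    have "(\<Sum>c\<in>?N. of_bool (odd (m c - v))) = (\<Sum>c\<in>?N. 1 - of_bool (odd (m c)) :: int)"
      using False by (intro sum.cong) auto
    also have "\<dots> = int (card ?N) - n1"
      unfolding n1_def TN using fin by (simp add: sum_subtractf of_bool_def sum.If_cases Int_def)
    finally show ?thesis using False by (simp add: cardN)
  qed
  also have "\<dots> \<le> (\<Sum>c\<in>?N. (m c - v)\<^sup>2)"
  proof (rule sum_mono)
    fix c
    show "of_bool (odd (m c - v)) \<le> (m c - v)\<^sup>2"
    proof (cases "m c = v")
      case False
      hence "1 \<le> (m c - v)\<^sup>2" by (simp add: int_one_le_iff_zero_less)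
      thus ?thesis by (auto simp: of_bool_def)
    qed simp
  qed
  finally show ?thesis
    unfolding total[symmetric] by (intro mult_left_mono) auto
qed

end

section \<open>Multipliers\<close>

lemma int_power_prime_cong:
  fixes x :: int
  assumes p: "Factorial_Ring.prime p"
  shows "[x ^ p = x] (mod int p)"
proof (cases "int p dvd x")
  case True
  hence "int p dvd x ^ p" using prime_gt_0_nat[OF p] by (meson dvd_power dvd_trans)
  thus ?thesis using True by (simp add: cong_iff_dvd_diff)
next
  case False
  define y where "y = nat (x mod int p)"
  have p0: "int p > 0" using prime_gt_0_nat[OF p] by simp
  have y: "[x = int y] (mod int p)" using p0 by (simp add: y_def cong_def)
  have "\<not> p dvd y" using False y by (metis cong_dvd_iff int_dvd_int_iff)
  hence "[y ^ (p - 1) = 1] (mod p)" using p fermat_theorem by blast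
  hence "[int y ^ (p - 1) = 1] (mod int p)" by (metis cong_int_iff of_nat_1 of_nat_power)
  hence "[x ^ (p - 1) = 1] (mod int p)" using y by (meson cong_pow cong_trans)
  hence "[x ^ (p - 1) * x = 1 * x] (mod int p)" by (rule cong_scalar_right)
  thus ?thesis using prime_gt_0_nat[OF p] by (simp flip: power_Suc2)
qed

lemma rotate1_eq_imp_replicate:
  assumes "rotate1 xs = xs"
  shows "xs = replicate (length xs) (hd xs)"
proof -
  have rot: "rotate k xs = xs" for k by (induction k) (simp_all add: assms)
  have "xs ! k = hd xs" if "k < length xs" for k
    using hd_rotate_conv_nth[of xs k] rot[of k] that by (cases "xs = []") auto
  thus ?thesis by (intro nth_equalityI) auto
qed

section \<open>Words and powers in the group ring\<close>

context comm_group
begin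

text \<open>The number of these words is the coefficient of \<open>g\<close> in the
  \<open>m\<close>-th power of \<open>D\<close> in the integral group ring.\<close>

definition words :: "'a set \<Rightarrow> nat \<Rightarrow> 'a \<Rightarrow> 'a list set" where
  "words D m g = {xs. length xs = m \<and> set xs \<subseteq> D \<and> foldr (\<otimes>) xs \<one> = g}"

lemma finite_words: "finite D \<Longrightarrow> finite (words D m g)"
  by (rule finite_subset[OF _ finite_lists_length_eq[of D m]]) (auto simp: words_def)

lemma foldr_mult_snoc:
  "\<lbrakk>set xs \<subseteq> carrier G; x \<in> carrier G\<rbrakk> \<Longrightarrow> foldr (\<otimes>) (xs @ [x]) \<one> = x \<otimes> foldr (\<otimes>) xs \<one>"
  by (induction xs) (auto simp: m_lcomm)

lemma foldr_mult_replicate: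
  "x \<in> carrier G \<Longrightarrow> foldr (\<otimes>) (replicate m x) \<one> = x [^] m"
  by (induction m) (simp_all add: m_comm)

text \<open>The Frobenius congruence in the group ring: rotation preserves the product by
  commutativity, and its fixed words are the constant ones.\<close>

lemma card_words_prime_cong:
  assumes D: "D \<subseteq> carrier G" "finite D" and p: "Factorial_Ring.prime p"
  shows "[card (words D p g) = card {x \<in> D. x [^] p = g}] (mod p)"
proof -
  have "[card (words D p g) = card {xs \<in> words D p g. rotate1 xs = xs}] (mod p)"
  proof (rule card_cong_card_fixpoints[OF p finite_words[OF D(2)]])
    fix xs assume xs: "xs \<in> words D p g"
    show "(rotate1 ^^ p) xs = xs"
      using rotate_id[of p xs] xs by (simp add: words_def rotate_def)
    have "foldr (\<otimes>) (rotate1 xs) \<one> = foldr (\<otimes>) xs \<one>"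
    proof (cases xs)
      case (Cons x ys)
      hence "set ys \<subseteq> carrier G" "x \<in> carrier G" using xs D(1) by (auto simp: words_def)
      thus ?thesis using Cons foldr_mult_snoc[of ys x] by simp
    qed simp
    thus "rotate1 xs \<in> words D p g" using xs by (simp add: words_def)
  qed
  moreover have "bij_betw (replicate p) {x \<in> D. x [^] p = g} {xs \<in> words D p g. rotate1 xs = xs}"
  proof (rule bij_betw_imageI)
    have p0: "p > 0" using prime_gt_0_nat[OF p] .
    show "inj_on (replicate p) {x \<in> D. x [^] p = g}"
      using p0 by (intro inj_onI) (simp add: replicate_eq_replicate)
    have rr: "rotate1 (replicate p x) = replicate p x" for x :: 'a
      using p0 by (cases p) (simp_all add: replicate_append_same)
    show "replicate p ` {x \<in> D. x [^] p = g} = {xs \<in> words D p g. rotate1 xs = xs}"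
    proof (intro equalityI subsetI)
      fix xs assume "xs \<in> replicate p ` {x \<in> D. x [^] p = g}"
      thus "xs \<in> {xs \<in> words D p g. rotate1 xs = xs}"
        using D(1) rr by (auto simp: words_def foldr_mult_replicate simp del: foldr_replicate)
    next
      fix xs assume xs: "xs \<in> {xs \<in> words D p g. rotate1 xs = xs}"
      hence e: "xs = replicate p (hd xs)" and ne: "xs \<noteq> []"
        using rotate1_eq_imp_replicate[of xs] p0 by (auto simp: words_def)
      have hd: "hd xs \<in> D" using xs ne by (auto simp: words_def)
      hence "foldr (\<otimes>) xs \<one> = hd xs [^] p" using e D(1) foldr_mult_replicate by (metis subsetD)
      thus "xs \<in> replicate p ` {x \<in> D. x [^] p = g}"
        using e hd xs by (intro image_eqI[of _ _ "hd xs"]) (auto simp: words_def)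
    qed
  qed
  ultimately show ?thesis by (simp add: bij_betw_same_card)
qed

lemma card_words_Suc:
  assumes D: "D \<subseteq> carrier G" "finite D" and g: "g \<in> carrier G"
  shows "card (words D (Suc m) g) = (\<Sum>x\<in>D. card (words D m (inv x \<otimes> g)))"
proof -
  have eq: "words D (Suc m) g = (\<Union>x\<in>D. (#) x ` words D m (inv x \<otimes> g))"
  proof (intro equalityI subsetI)
    fix xs assume "xs \<in> words D (Suc m) g"
    then obtain x ys where xs: "xs = x # ys" and H: "length ys = m" "x \<in> D" "set ys \<subseteq> D"
      "x \<otimes> foldr (\<otimes>) ys \<one> = g"
      by (cases xs) (auto simp: words_def)
    have "foldr (\<otimes>) ys \<one> \<in> carrier G" using H D(1) by (intro multlist_closed) auto
    moreover have "x \<in> carrier G" using H D(1) by blast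
    ultimately have "foldr (\<otimes>) ys \<one> = inv x \<otimes> g"
      unfolding H(4)[symmetric] by (simp add: m_assoc[symmetric])
    thus "xs \<in> (\<Union>x\<in>D. (#) x ` words D m (inv x \<otimes> g))" using xs H by (auto simp: words_def)
  next
    fix xs assume "xs \<in> (\<Union>x\<in>D. (#) x ` words D m (inv x \<otimes> g))"
    then obtain x ys where xs: "xs = x # ys" and H: "length ys = m" "x \<in> D" "set ys \<subseteq> D"
      "foldr (\<otimes>) ys \<one> = inv x \<otimes> g"
      by (auto simp: words_def)
    have "x \<otimes> (inv x \<otimes> g) = g" using H(2) D(1) g by (subst m_assoc[symmetric]) auto
    thus "xs \<in> words D (Suc m) g" using xs H by (auto simp: words_def)
  qed
  have "card (words D (Suc m) g) = (\<Sum>x\<in>D. card ((#) x ` words D m (inv x \<otimes> g)))"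
    unfolding eq using D(2) by (intro card_UN_disjoint) (auto simp: finite_words)
  also have "\<dots> = (\<Sum>x\<in>D. card (words D m (inv x \<otimes> g)))"
    by (intro sum.cong refl card_image inj_onI) auto
  finally show ?thesis .
qed

end

text \<open>\<open>card_products\<close> is the group-ring equation for the square of
  \<open>D\<close>, with products in place of quotients and the identity included.\<close>

locale latin_pds = comm_group G
  for G :: "('a, 'm) monoid_scheme" (structure) +
  fixes D :: "'a set" and n :: nat and r eps :: int
  assumes finite_carrier: "finite (carrier G)" and n_gt_1: "n > 1" and order_G: "order G = n\<^sup>2"
    and eps: "eps = 1 \<or> eps = -1"
    and D_subset: "D \<subseteq> carrier G - {\<one>}"
    and D_inv: "x \<in> D \<Longrightarrow> inv x \<in> D"
    and card_D: "int (card D) = r * (int n - eps)"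
    and card_products: "g \<in> carrier G \<Longrightarrow> int (card {(x, y). x \<in> D \<and> y \<in> D \<and> x \<otimes> y = g}) =
      (int n * r - r\<^sup>2) * of_bool (g = \<one>) + eps * (int n - 2 * r) * of_bool (g \<in> D) + (r\<^sup>2 - eps * r)"
begin

lemma finite_D: "finite D"
  using D_subset finite_carrier by (meson Diff_subset finite_subset)

lemma D_carrier: "x \<in> D \<Longrightarrow> x \<in> carrier G"
  using D_subset by auto

lemma one_notin: "\<one> \<notin> D"
  using D_subset by auto

text \<open>Up to multiples of the whole group, \<open>D\<close> satisfies a quadratic with roots
  \<open>eps * (n - r)\<close> and \<open>- eps * r\<close>. Its \<open>m\<close>-th power reduces
  to a linear remainder determined by the values at the two roots; \<open>\<gamma>\<close> collects
  the multiples of the whole group.\<close>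

lemma card_words:
  "\<exists>\<alpha> \<gamma>. eps * int n * \<alpha> = (eps * (int n - r)) ^ m - (- eps * r) ^ m \<and>
    (\<forall>g\<in>carrier G. int (card (words D m g)) =
      \<alpha> * of_bool (g \<in> D) + ((- eps * r) ^ m - \<alpha> * (- eps * r)) * of_bool (g = \<one>) + \<gamma>)"
proof (induction m)
  case 0
  have "words D 0 g = (if g = \<one> then {[]} else {})" for g by (auto simp: words_def)
  thus ?case by (intro exI[of _ 0]) auto
next
  case (Suc m)
  define \<theta> where "\<theta> = - eps * r"
  define \<rho> where "\<rho> = eps * (int n - r)"
  have prod: "\<rho> * \<theta> = - (int n * r - r\<^sup>2)" and sum: "\<rho> + \<theta> = eps * (int n - 2 * r)"
    using eps by (auto simp: \<rho>_def \<theta>_def power2_eq_square algebra_simps)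
  from Suc obtain \<alpha> \<gamma> where a: "eps * int n * \<alpha> = \<rho> ^ m - \<theta> ^ m"
    and c: "\<And>g. g \<in> carrier G \<Longrightarrow> int (card (words D m g)) =
      \<alpha> * of_bool (g \<in> D) + (\<theta> ^ m - \<alpha> * \<theta>) * of_bool (g = \<one>) + \<gamma>"
    unfolding \<theta>_def \<rho>_def by blast
  \<comment> \<open>Multiplying by one more \<open>D\<close> and reducing the square gives these
    coefficients; the whole group times \<open>D\<close> is \<open>card D\<close> copies of
    itself.\<close>
  define \<alpha>' where "\<alpha>' = \<alpha> * \<rho> + \<theta> ^ m"
  define \<gamma>' where "\<gamma>' = \<alpha> * (r\<^sup>2 - eps * r) + \<gamma> * int (card D)"
  have diff: "eps * int n = \<rho> - \<theta>" by (simp add: \<rho>_def \<theta>_def algebra_simps)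
  have "eps * int n * \<alpha>' = (eps * int n * \<alpha>) * \<rho> + (eps * int n) * \<theta> ^ m"
    by (simp add: \<alpha>'_def algebra_simps)
  also have "\<dots> = (\<rho> ^ m - \<theta> ^ m) * \<rho> + (\<rho> - \<theta>) * \<theta> ^ m"
    by (subst a, subst diff) (rule refl)
  also have "\<dots> = \<rho> ^ Suc m - \<theta> ^ Suc m" by (simp add: algebra_simps)
  finally have 1: "eps * int n * \<alpha>' = \<rho> ^ Suc m - \<theta> ^ Suc m" .
  have 2: "int (card (words D (Suc m) g)) =
      \<alpha>' * of_bool (g \<in> D) + (\<theta> ^ Suc m - \<alpha>' * \<theta>) * of_bool (g = \<one>) + \<gamma>'" if g: "g \<in> carrier G" for g
  proof -
    have s1: "(\<Sum>x\<in>D. of_bool (inv x \<otimes> g \<in> D)) = int (card {(x, y). x \<in> D \<and> y \<in> D \<and> x \<otimes> y = g})"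
    proof -
      have "bij_betw (\<lambda>x. (x, inv x \<otimes> g)) {x \<in> D. inv x \<otimes> g \<in> D} {(x, y). x \<in> D \<and> y \<in> D \<and> x \<otimes> y = g}"
      proof (rule bij_betw_byWitness[where f' = fst])
        show "(\<lambda>x. (x, inv x \<otimes> g)) ` {x \<in> D. inv x \<otimes> g \<in> D} \<subseteq> {(x, y). x \<in> D \<and> y \<in> D \<and> x \<otimes> y = g}"
          using g by (auto simp: D_carrier m_assoc[symmetric])
        have "inv x \<otimes> (x \<otimes> y) = y" if "x \<in> D" "y \<in> D" for x y
          using that by (simp add: D_carrier m_assoc[symmetric])
        thus "\<forall>p\<in>{(x, y). x \<in> D \<and> y \<in> D \<and> x \<otimes> y = g}. (fst p, inv fst p \<otimes> g) = p"
          "fst ` {(x, y). x \<in> D \<and> y \<in> D \<and> x \<otimes> y = g} \<subseteq> {x \<in> D. inv x \<otimes> g \<in> D}"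
          by auto
      qed auto
      hence "card {x \<in> D. inv x \<otimes> g \<in> D} = card {(x, y). x \<in> D \<and> y \<in> D \<and> x \<otimes> y = g}"
        by (rule bij_betw_same_card)
      thus ?thesis using finite_D by (simp add: of_bool_def sum.If_cases Int_def)
    qed
    have "inv x \<otimes> g = \<one> \<longleftrightarrow> g = x" if "x \<in> D" for x
    proof
      assume "inv x \<otimes> g = \<one>"
      thus "g = x" using that g D_carrier by (metis inv_closed inv_equality inv_inv m_comm)
    qed (use that in \<open>simp add: D_carrier\<close>)
    hence s2: "(\<Sum>x\<in>D. of_bool (inv x \<otimes> g = \<one>)) = (of_bool (g \<in> D) :: int)"
      using finite_D by (simp add: of_bool_def)
    have "int (card (words D (Suc m) g)) = (\<Sum>x\<in>D. int (card (words D m (inv x \<otimes> g))))"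
      by (subst card_words_Suc[OF _ finite_D g]) (auto simp: D_carrier)
    also have "\<dots> = (\<Sum>x\<in>D. \<alpha> * of_bool (inv x \<otimes> g \<in> D) +
        (\<theta> ^ m - \<alpha> * \<theta>) * of_bool (inv x \<otimes> g = \<one>) + \<gamma>)"
      using g by (intro sum.cong refl c) (simp add: D_carrier)
    also have "\<dots> = \<alpha> * (\<Sum>x\<in>D. of_bool (inv x \<otimes> g \<in> D)) +
        (\<theta> ^ m - \<alpha> * \<theta>) * (\<Sum>x\<in>D. of_bool (inv x \<otimes> g = \<one>)) + \<gamma> * int (card D)"
      by (simp only: sum.distrib sum_distrib_left) simp
    also have "\<dots> = \<alpha>' * of_bool (g \<in> D) + (\<theta> ^ Suc m - \<alpha>' * \<theta>) * of_bool (g = \<one>) + \<gamma>'"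
    proof -
      have "\<theta> ^ Suc m - \<alpha>' * \<theta> = - (\<alpha> * (\<rho> * \<theta>))"
        by (simp add: \<alpha>'_def algebra_simps)
      hence e1: "\<theta> ^ Suc m - \<alpha>' * \<theta> = \<alpha> * (int n * r - r\<^sup>2)"
        unfolding prod by (simp add: algebra_simps)
      have e2: "\<alpha>' = \<alpha> * (eps * (int n - 2 * r)) + (\<theta> ^ m - \<alpha> * \<theta>)"
        unfolding sum[symmetric] by (simp add: \<alpha>'_def algebra_simps)
      show ?thesis
        unfolding s1 s2 card_products[OF g] \<gamma>'_def
        by (subst e1, subst e2) (simp add: algebra_simps)
    qed
    finally show ?thesis .
  qed
  show ?case using 1 2 unfolding \<theta>_def \<rho>_def by blast
qed

text \<open>Modulo \<open>p\<close>, Fermat and invertibility of \<open>n\<close> turn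
  \<open>card_words\<close> into \<open>of_bool (g \<in> D) + \<gamma>\<close> for the number of
  \<open>p\<close>-th roots of \<open>g\<close> in \<open>D\<close>. Once \<open>\<gamma>\<close> is
  seen to vanish, every element of \<open>D\<close> has such a root, and finiteness makes the power
  map a permutation of \<open>D\<close>.\<close>

lemma pow_prime_mem:
  assumes p: "Factorial_Ring.prime p" "\<not> p dvd n" and x: "x \<in> D"
  shows "x [^] p \<in> D"
proof -
  define \<theta> where "\<theta> = - eps * r"
  define \<rho> where "\<rho> = eps * (int n - r)"
  obtain \<alpha> \<gamma> where a: "eps * int n * \<alpha> = \<rho> ^ p - \<theta> ^ p"
    and c: "\<And>g. g \<in> carrier G \<Longrightarrow> int (card (words D p g)) =
      \<alpha> * of_bool (g \<in> D) + (\<theta> ^ p - \<alpha> * \<theta>) * of_bool (g = \<one>) + \<gamma>"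
    using card_words[of p] unfolding \<theta>_def \<rho>_def by blast
  have diff: "eps * int n = \<rho> - \<theta>" by (simp add: \<rho>_def \<theta>_def algebra_simps)
  have "[eps * int n * \<alpha> = eps * int n] (mod int p)"
    unfolding a by (subst diff) (intro cong_diff int_power_prime_cong p)
  moreover have "coprime (eps * int n) (int p)"
  proof -
    have "coprime (int n) (int p)" using p by (metis coprime_commute coprime_int_iff prime_imp_coprime)
    thus ?thesis using eps by auto
  qed
  ultimately have \<alpha>: "[\<alpha> = 1] (mod int p)"
    by (metis cong_mult_lcancel mult.right_neutral)
  hence "[\<theta> ^ p - \<alpha> * \<theta> = \<theta> - 1 * \<theta>] (mod int p)"
    by (intro cong_diff cong_mult int_power_prime_cong p) auto
  hence \<beta>: "[\<theta> ^ p - \<alpha> * \<theta> = 0] (mod int p)" by simp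
  have fib: "[int (card {x \<in> D. x [^] p = g}) = of_bool (g \<in> D) + \<gamma>] (mod int p)"
    if g: "g \<in> carrier G" for g
  proof -
    have "[int (card (words D p g)) = int (card {x \<in> D. x [^] p = g})] (mod int p)"
      using card_words_prime_cong[OF _ finite_D p(1)] D_carrier by (simp add: cong_int_iff subset_iff)
    moreover have "[int (card (words D p g)) = 1 * of_bool (g \<in> D) + 0 * of_bool (g = \<one>) + \<gamma>] (mod int p)"
      unfolding c[OF g] by (intro cong_add cong_mult \<alpha> \<beta> cong_refl)
    ultimately show ?thesis by (simp add: cong_def)
  qed
  \<comment> \<open>\<open>\<gamma>\<close> is computed at the identity: a \<open>p\<close>-th root
    of it in \<open>D\<close> would be the identity itself, which \<open>D\<close> omits.\<close>
  have cop: "coprime p (order G)" using p by (simp add: order_G prime_imp_coprime)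
  have "y = \<one>" if "y \<in> D" "y [^] p = \<one>" for y
    using pow_coprime_eq_one[OF D_carrier[OF that(1)] that(2) _ cop] pow_order_eq_1 D_carrier that by blast
  hence "{x \<in> D. x [^] p = \<one>} = {}" using one_notin by auto
  hence "card {x \<in> D. x [^] p = \<one>} = 0" by (simp only: card.empty)
  hence \<gamma>: "[\<gamma> = 0] (mod int p)"
    using fib[OF one_closed] one_notin by (simp add: cong_sym_eq)
  have "D \<subseteq> (\<lambda>x. x [^] p) ` D"
  proof
    fix g assume g: "g \<in> D"
    have "[int (card {x \<in> D. x [^] p = g}) = 1 + \<gamma>] (mod int p)"
      using fib[OF D_carrier[OF g]] g by simp
    hence *: "[int (card {x \<in> D. x [^] p = g}) = 1 + 0] (mod int p)"
      by (rule cong_trans[OF _ cong_add[OF cong_refl \<gamma>]])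
    have "card {x \<in> D. x [^] p = g} \<noteq> 0"
    proof
      assume "card {x \<in> D. x [^] p = g} = 0"
      hence "[0 = 1] (mod int p)" using * by simp
      thus False using prime_gt_1_nat[OF p(1)] by (simp add: cong_def)
    qed
    hence "{x \<in> D. x [^] p = g} \<noteq> {}" by (metis card.empty)
    thus "g \<in> (\<lambda>x. x [^] p) ` D" by blast
  qed
  hence "D = (\<lambda>x. x [^] p) ` D"
    by (intro card_seteq finite_imageI finite_D card_image_le)
  thus ?thesis using x by blast
qed

lemma pow_mem:
  assumes "coprime s n" "x \<in> D"
  shows "x [^] s \<in> D"
  using assms
proof (induction s arbitrary: x rule: prime_divisors_induct)
  case zero
  thus ?case using n_gt_1 by simp
next
  case (unit s)
  thus ?case using D_carrier by simp
next
  case (factor p s)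
  have "coprime p n" "coprime s n" using factor.prems(1) by auto
  hence "\<not> p dvd n" using factor.hyps by (metis coprime_absorb_left not_prime_unit)
  hence "x [^] p \<in> D" using pow_prime_mem factor by blast
  hence "(x [^] p) [^] s \<in> D" using factor.IH \<open>coprime s n\<close> by blast
  thus ?case using D_carrier[OF factor.prems(2)] by (simp add: nat_pow_pow)
qed

end

section \<open>The dual set\<close>

context latin_pds
begin

text \<open>The group-ring equation for the square of \<open>D\<close>, tested against
  \<open>f\<close>; for a character it becomes a quadratic equation for its sum over
  \<open>D\<close>.\<close>

lemma sum_over_products:
  fixes f :: "'a \<Rightarrow> complex"
  shows "(\<Sum>x\<in>D. \<Sum>y\<in>D. f (x \<otimes> y)) = of_int (int n * r - r\<^sup>2) * f \<one> +
    of_int (eps * (int n - 2 * r)) * (\<Sum>x\<in>D. f x) + of_int (r\<^sup>2 - eps * r) * (\<Sum>g\<in>carrier G. f g)"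
proof -
  have "(\<Sum>x\<in>D. \<Sum>y\<in>D. f (x \<otimes> y)) = (\<Sum>p\<in>D \<times> D. f (fst p \<otimes> snd p))"
    by (simp add: sum.cartesian_product case_prod_beta)
  also have "\<dots> = (\<Sum>g\<in>carrier G. \<Sum>p\<in>{p \<in> D \<times> D. fst p \<otimes> snd p = g}. f (fst p \<otimes> snd p))"
    using finite_D finite_carrier by (intro sum.group[symmetric]) (auto simp: D_carrier)
  also have "\<dots> = (\<Sum>g\<in>carrier G. of_int (int (card {(x, y). x \<in> D \<and> y \<in> D \<and> x \<otimes> y = g})) * f g)"
  proof (rule sum.cong[OF refl])
    fix g
    have "{p \<in> D \<times> D. fst p \<otimes> snd p = g} = {(x, y). x \<in> D \<and> y \<in> D \<and> x \<otimes> y = g}" by auto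
    moreover have "(\<Sum>p\<in>{p \<in> D \<times> D. fst p \<otimes> snd p = g}. f (fst p \<otimes> snd p)) =
        (\<Sum>p\<in>{p \<in> D \<times> D. fst p \<otimes> snd p = g}. f g)" by (intro sum.cong) auto
    ultimately show "(\<Sum>p\<in>{p \<in> D \<times> D. fst p \<otimes> snd p = g}. f (fst p \<otimes> snd p)) =
        of_int (int (card {(x, y). x \<in> D \<and> y \<in> D \<and> x \<otimes> y = g})) * f g" by simp
  qed
  also have "\<dots> = (\<Sum>g\<in>carrier G. of_int (int n * r - r\<^sup>2) * (of_bool (g = \<one>) * f g) +
      of_int (eps * (int n - 2 * r)) * (of_bool (g \<in> D) * f g) + of_int (r\<^sup>2 - eps * r) * f g)"
    by (intro sum.cong refl) (simp add: card_products algebra_simps)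
  also have "\<dots> = of_int (int n * r - r\<^sup>2) * (\<Sum>g\<in>carrier G. of_bool (g = \<one>) * f g) +
      of_int (eps * (int n - 2 * r)) * (\<Sum>g\<in>carrier G. of_bool (g \<in> D) * f g) +
      of_int (r\<^sup>2 - eps * r) * (\<Sum>g\<in>carrier G. f g)"
    by (simp only: sum.distrib sum_distrib_left)
  also have "(\<Sum>g\<in>carrier G. of_bool (g = \<one>) * f g) = f \<one>"
    using finite_carrier by (simp add: of_bool_def if_distrib[of "\<lambda>z. z * _"] cong: if_cong)
  also have "(\<Sum>g\<in>carrier G. of_bool (g \<in> D) * f g) = (\<Sum>x\<in>D. f x)"
  proof -
    have "carrier G \<inter> D = D" using D_carrier by auto
    thus ?thesis using sum.inter_restrict[OF finite_carrier, of f D]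
      by (simp add: of_bool_def if_distrib[of "\<lambda>z. z * _"] cong: if_cong)
  qed
  finally show ?thesis .
qed

end

locale latin_pds_dual = latin_pds G D n r eps + dual_pair G B w
  for G :: "('a, 'm) monoid_scheme" (structure) and D n r eps
    and B :: "('b, 'k) monoid_scheme" and w
begin

definition char_sum :: "'b \<Rightarrow> complex" where "char_sum c = (\<Sum>x\<in>D. w x c)"

definition dual_set :: "'b set" where
  "dual_set = {c \<in> carrier B - {\<one>\<^bsub>B\<^esub>}. char_sum c = of_int (eps * (int n - r))}"

lemma char_sum_eq:
  assumes c: "c \<in> carrier B" "c \<noteq> \<one>\<^bsub>B\<^esub>"
  shows "char_sum c = of_int (eps * (int n * of_bool (c \<in> dual_set) - r))"
proof -
  interpret C: dual_pair B G "\<lambda>c x. w x c" by (rule swap)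
  let ?X = "char_sum c"
  have "?X * ?X = (\<Sum>x\<in>D. \<Sum>y\<in>D. w (x \<otimes> y) c)"
    unfolding char_sum_def sum_product using c
    by (intro sum.cong refl) (simp add: mult_left D_carrier)
  also have "\<dots> = of_int (int n * r - r\<^sup>2) + of_int (eps * (int n - 2 * r)) * ?X"
    unfolding sum_over_products[of "\<lambda>x. w x c"] char_sum_def
    using c by (simp add: one_left C.sum_right_eq_0)
  finally have "(?X - of_int (eps * (int n - r))) * (?X + of_int (eps * r)) = 0"
    using eps by (auto simp: algebra_simps power2_eq_square)
  hence "?X = of_int (eps * (int n - r)) \<or> ?X = of_int (- eps * r)"
    by (auto simp: eq_neg_iff_add_eq_0)
  moreover have "of_int (eps * (int n - r)) \<noteq> (of_int (- eps * r) :: complex)"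
    unfolding of_int_eq_iff using eps n_gt_1 by (auto simp: algebra_simps)
  ultimately show ?thesis using c by (auto simp: dual_set_def)
qed

text \<open>Fourier inversion: the transform of \<open>char_sum\<close> at \<open>g\<close> is
  computed once by orthogonality and once by sorting the characters by their value. It yields both
  the character sums and the size of \<open>dual_set\<close>.\<close>

lemma dual_set_sum:
  assumes g: "g \<in> carrier G"
  shows "of_int (int n ^ 2 * of_bool (g \<in> D)) = of_int (r * int n) +
    of_int (eps * int n) * (\<Sum>c\<in>dual_set. w g c) - of_int (eps * r) * of_int (int n ^ 2 * of_bool (g = \<one>))"
proof -
  have oneB: "\<one>\<^bsub>B\<^esub> \<in> carrier B" by simp
  have orderB: "order B = n\<^sup>2" using order_eq order_G by simp
  have sub: "dual_set \<subseteq> carrier B - {\<one>\<^bsub>B\<^esub>}" by (auto simp: dual_set_def)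
  have inv_iff: "x \<otimes> g = \<one> \<longleftrightarrow> x = inv g" if "x \<in> D" for x
    using that g D_carrier by (metis inv_equality l_inv)
  have mem_iff: "inv g \<in> D \<longleftrightarrow> g \<in> D" using D_inv g by (metis inv_inv)
  have "(\<Sum>c\<in>carrier B. char_sum c * w g c) = (\<Sum>x\<in>D. \<Sum>c\<in>carrier B. w (x \<otimes> g) c)"
    unfolding char_sum_def sum_distrib_right using g
    by (subst sum.swap) (intro sum.cong refl, simp add: mult_left D_carrier)
  also have "\<dots> = (\<Sum>x\<in>D. of_nat (order B) * of_bool (x = inv g))"
    using g by (intro sum.cong refl) (simp add: sum_right D_carrier inv_iff)
  also have "\<dots> = of_int (int n ^ 2 * of_bool (g \<in> D))"
    using finite_D mem_iff by (simp add: orderB of_bool_def if_distrib cong: if_cong)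
  finally have 1: "(\<Sum>c\<in>carrier B. char_sum c * w g c) = of_int (int n ^ 2 * of_bool (g \<in> D))" .
  have "char_sum \<one>\<^bsub>B\<^esub> = of_int (r * (int n - eps))"
    unfolding char_sum_def card_D[symmetric] by (simp add: one_right D_carrier)
  hence "(\<Sum>c\<in>carrier B. char_sum c * w g c) = of_int (r * (int n - eps)) +
      (\<Sum>c\<in>carrier B - {\<one>\<^bsub>B\<^esub>}. char_sum c * w g c)"
    using sum.remove[OF finite_B oneB, of "\<lambda>c. char_sum c * w g c"] g by (simp add: one_right)
  also have "(\<Sum>c\<in>carrier B - {\<one>\<^bsub>B\<^esub>}. char_sum c * w g c) = (\<Sum>c\<in>carrier B - {\<one>\<^bsub>B\<^esub>}.
      of_int (eps * int n) * (if c \<in> dual_set then w g c else 0) - of_int (eps * r) * w g c)"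
    by (intro sum.cong refl) (auto simp: char_sum_eq algebra_simps)
  also have "\<dots> = of_int (eps * int n) * (\<Sum>c\<in>carrier B - {\<one>\<^bsub>B\<^esub>}. if c \<in> dual_set then w g c else 0) -
      of_int (eps * r) * (\<Sum>c\<in>carrier B - {\<one>\<^bsub>B\<^esub>}. w g c)"
    by (simp only: sum_subtractf sum_distrib_left)
  also have "(\<Sum>c\<in>carrier B - {\<one>\<^bsub>B\<^esub>}. if c \<in> dual_set then w g c else 0) = (\<Sum>c\<in>dual_set. w g c)"
    using sub finite_B by (simp add: sum.inter_restrict[symmetric] Int_absorb1)
  also have "(\<Sum>c\<in>carrier B - {\<one>\<^bsub>B\<^esub>}. w g c) = of_int (int n ^ 2 * of_bool (g = \<one>)) - 1"
    using sum.remove[OF finite_B oneB, of "w g"] sum_right[OF g] g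
    by (simp add: one_right orderB algebra_simps)
  finally have 2: "(\<Sum>c\<in>carrier B. char_sum c * w g c) = of_int (r * (int n - eps)) +
      (of_int (eps * int n) * (\<Sum>c\<in>dual_set. w g c) -
       of_int (eps * r) * (of_int (int n ^ 2 * of_bool (g = \<one>)) - 1))" .
  show ?thesis using 1[unfolded 2] by (simp add: algebra_simps)
qed

lemma sum_dual_set:
  assumes g: "g \<in> carrier G" "g \<noteq> \<one>"
  shows "(\<Sum>c\<in>dual_set. w g c) = of_int (eps * (int n * of_bool (g \<in> D) - r))"
proof -
  have "complex_of_int (eps * int n) * (\<Sum>c\<in>dual_set. w g c) =
      of_int (int n ^ 2 * of_bool (g \<in> D) - r * int n)"
    using dual_set_sum[OF g(1)] g(2) by (simp add: algebra_simps)
  also have "int n ^ 2 * of_bool (g \<in> D) - r * int n =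
      (eps * int n) * (eps * (int n * of_bool (g \<in> D) - r))"
    using eps by (auto simp: power2_eq_square algebra_simps)
  finally have "complex_of_int (eps * int n) * (\<Sum>c\<in>dual_set. w g c) =
      of_int (eps * int n) * of_int (eps * (int n * of_bool (g \<in> D) - r))" by (simp only: of_int_mult)
  moreover have "complex_of_int (eps * int n) \<noteq> 0" using eps n_gt_1 by auto
  ultimately show ?thesis by (metis mult_cancel_left)
qed

lemma card_dual_set: "int (card dual_set) = r * (int n - eps)"
proof -
  have "(\<Sum>c\<in>dual_set. w \<one> c) = of_nat (card dual_set)"
    by (simp add: one_left dual_set_def)
  hence "complex_of_int (eps * int n * int (card dual_set)) = of_int (eps * r * int n ^ 2 - r * int n)"
    using dual_set_sum[OF one_closed] one_notin by (simp add: algebra_simps)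
  hence "eps * int n * int (card dual_set) = eps * r * int n ^ 2 - r * int n"
    by (simp only: of_int_eq_iff)
  also have "\<dots> = eps * int n * (r * (int n - eps))"
    using eps by (auto simp: power2_eq_square algebra_simps)
  finally show ?thesis using eps n_gt_1 by auto
qed

text \<open>The \<open>s\<close>-th power permutes \<open>D\<close>, and in the pairing the exponent
  moves from \<open>x\<close> to \<open>c\<close>, so \<open>c\<close> and its power have equal
  character sums.\<close>

lemma dual_set_pow:
  assumes s: "coprime s n" and c: "c \<in> dual_set"
  shows "c [^]\<^bsub>B\<^esub> s \<in> dual_set"
proof -
  have cB: "c \<in> carrier B" "c \<noteq> \<one>\<^bsub>B\<^esub>" using c by (auto simp: dual_set_def)
  have cop: "coprime s (order B)" using s by (simp add: order_eq[symmetric] order_G)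
  have "inj_on (\<lambda>x. x [^] s) D"
  proof (rule inj_onI)
    fix x y assume xy: "x \<in> D" "y \<in> D" "x [^] s = y [^] s"
    hence "(x \<otimes> inv y) [^] s = \<one>" by (simp add: D_carrier nat_pow_distrib nat_pow_inv)
    moreover have "(x \<otimes> inv y) [^] order G = \<one>" using xy by (simp add: D_carrier pow_order_eq_1)
    ultimately have "x \<otimes> inv y = \<one>"
      using pow_coprime_eq_one[of "x \<otimes> inv y" s "order G"] xy s by (simp add: D_carrier order_G)
    thus "x = y" using xy D_carrier by (metis inv_closed inv_equality inv_inv)
  qed
  moreover have "(\<lambda>x. x [^] s) ` D \<subseteq> D" using pow_mem[OF s] by auto
  ultimately have "bij_betw (\<lambda>x. x [^] s) D D"
    unfolding bij_betw_def using finite_D by (simp add: endo_inj_surj)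
  hence "(\<Sum>x\<in>D. w (x [^] s) c) = char_sum c"
    unfolding char_sum_def by (rule sum.reindex_bij_betw)
  moreover have "(\<Sum>x\<in>D. w (x [^] s) c) = char_sum (c [^]\<^bsub>B\<^esub> s)"
    unfolding char_sum_def using cB
    by (intro sum.cong refl) (simp add: pow_left pow_right D_carrier)
  moreover have "c [^]\<^bsub>B\<^esub> s \<noteq> \<one>\<^bsub>B\<^esub>"
    using B.pow_coprime_eq_one[OF cB(1) _ B.pow_order_eq_1[OF cB(1)] cop] cB(2) by blast
  ultimately show ?thesis using c by (simp add: dual_set_def)
qed

lemma dual_set_inv:
  assumes c: "c \<in> dual_set"
  shows "inv\<^bsub>B\<^esub> c \<in> dual_set"
proof -
  have cB: "c \<in> carrier B" using c by (auto simp: dual_set_def)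
  have n2: "n\<^sup>2 > 0" using n_gt_1 by simp
  have "coprime (n\<^sup>2 - 1) (n\<^sup>2)" using coprime_diff_one_left_nat[OF n2] .
  hence "c [^]\<^bsub>B\<^esub> (n\<^sup>2 - 1) \<in> dual_set" using dual_set_pow[OF _ c] by simp
  moreover have "c [^]\<^bsub>B\<^esub> (n\<^sup>2 - 1) \<otimes>\<^bsub>B\<^esub> c = \<one>\<^bsub>B\<^esub>"
    using B.pow_order_eq_1[OF cB] order_eq order_G n2 by (simp flip: B.nat_pow_Suc)
  hence "inv\<^bsub>B\<^esub> c = c [^]\<^bsub>B\<^esub> (n\<^sup>2 - 1)" using cB by (metis B.inv_equality B.nat_pow_closed)
  ultimately show ?thesis by simp
qed

lemma pds_pairs:
  assumes ab: "n = a * b" "coprime a b" "odd b"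
  shows "pds_pair G B w a b r eps D dual_set"
    and "pds_pair B G (\<lambda>c x. w x c) a b r eps dual_set D"
proof -
  interpret C: dual_pair B G "\<lambda>c x. w x c" by (rule swap)
  have a: "a > 0" using ab(1) n_gt_1 by (cases a) auto
  have o: "order G = a\<^sup>2 * b\<^sup>2" "order B = a\<^sup>2 * b\<^sup>2"
    using order_G order_eq ab(1) by (simp_all add: power_mult_distrib)
  show "pds_pair G B w a b r eps D dual_set"
  proof (rule pds_pair.intro[OF dual_pair_axioms pds_pair_axioms.intro])
    show "dual_set \<subseteq> carrier B - {\<one>\<^bsub>B\<^esub>}" by (auto simp: dual_set_def)
    show "c [^]\<^bsub>B\<^esub> s \<in> dual_set" if "coprime s (a * b)" "c \<in> dual_set" for s :: nat and c
      using dual_set_pow that ab(1) by simp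
    show "(\<Sum>x\<in>D. w x c) = of_int (eps * (int a * int b * of_bool (c \<in> dual_set) - r))"
      if "c \<in> carrier B" "c \<noteq> \<one>\<^bsub>B\<^esub>" for c
      using char_sum_eq[OF that] ab(1) by (simp add: char_sum_def)
    show "int (card D) = r * (int a * int b - eps)" using card_D ab(1) by simp
  qed (fact a o ab eps D_subset D_inv)+
  show "pds_pair B G (\<lambda>c x. w x c) a b r eps dual_set D"
  proof (rule pds_pair.intro[OF C.dual_pair_axioms pds_pair_axioms.intro])
    show "dual_set \<subseteq> carrier B - {\<one>\<^bsub>B\<^esub>}" by (auto simp: dual_set_def)
    show "x [^] s \<in> D" if "coprime s (a * b)" "x \<in> D" for s :: nat and x
      using pow_mem that ab(1) by simp
    show "(\<Sum>c\<in>dual_set. w x c) = of_int (eps * (int a * int b * of_bool (x \<in> D) - r))"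
      if "x \<in> carrier G" "x \<noteq> \<one>" for x
      using sum_dual_set[OF that] ab(1) by simp
    show "int (card dual_set) = r * (int a * int b - eps)" using card_dual_set ab(1) by simp
  qed (fact a o ab eps D_subset dual_set_inv)+
qed

end

section \<open>Partial difference sets of Latin square type\<close>

text \<open>By \<open>ne\<close> the two multiplicities differ, their difference being
  \<open>eps * (n - 2 * r)\<close>. Swapping entries gives equal counts at an element and its
  inverse, which forces inverse-closure; counting all pairs excludes the identity.\<close>

lemma pds_latin_pds:
  fixes G :: "('a, 'b) monoid_scheme" and D :: "'a set" and r eps :: int and n :: nat
  assumes G: "comm_group G" and n: "n > 1" and eps: "eps = 1 \<or> eps = -1"
    and D: "pds G D (int (n\<^sup>2)) (r * (int n - eps))
              (eps * int n + r\<^sup>2 - 3 * eps * r) (r\<^sup>2 - eps * r)"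
    and ne: "int n \<noteq> 2 * r"
  shows "latin_pds G D n r eps"
proof -
  interpret comm_group G by (rule G)
  define lam where "lam = eps * int n + r\<^sup>2 - 3 * eps * r"
  define mu where "mu = r\<^sup>2 - eps * r"
  define diffs where "diffs g = {(x, y). x \<in> D \<and> y \<in> D \<and> x \<noteq> y \<and> x \<otimes>\<^bsub>G\<^esub> inv\<^bsub>G\<^esub> y = g}" for g
  have fin: "finite (carrier G)" and ord: "int (card (carrier G)) = int (n\<^sup>2)" and sub: "D \<subseteq> carrier G"
    and card: "int (card D) = r * (int n - eps)"
    and cnt: "\<And>g. g \<in> carrier G \<Longrightarrow> g \<noteq> \<one>\<^bsub>G\<^esub> \<Longrightarrow> int (card (diffs g)) = (if g \<in> D then lam else mu)"
    using D unfolding pds_def lam_def mu_def diffs_def by auto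
  have car: "x \<in> carrier G" if "x \<in> D" for x using sub that by blast
  have finD: "finite D" using sub fin finite_subset by blast
  have neq: "lam \<noteq> mu" using ne eps unfolding lam_def mu_def by auto
  have eq_one: "x \<otimes>\<^bsub>G\<^esub> inv\<^bsub>G\<^esub> y = \<one>\<^bsub>G\<^esub> \<longleftrightarrow> x = y" if "x \<in> D" "y \<in> D" for x y
    using that car by (metis inv_closed inv_equality inv_inv r_inv)
  have swap_mem: "(y, x) \<in> diffs (inv\<^bsub>G\<^esub> g)" if xy: "(x, y) \<in> diffs g" for x y g
  proof -
    have *: "x \<in> D" "y \<in> D" "x \<noteq> y" "x \<otimes>\<^bsub>G\<^esub> inv\<^bsub>G\<^esub> y = g"
      using xy by (auto simp: diffs_def)
    have "y \<otimes>\<^bsub>G\<^esub> inv\<^bsub>G\<^esub> x = inv\<^bsub>G\<^esub> (x \<otimes>\<^bsub>G\<^esub> inv\<^bsub>G\<^esub> y)"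
      using car[OF *(1)] car[OF *(2)] by (simp add: inv_mult m_comm)
    thus ?thesis using * by (simp add: diffs_def)
  qed
  have swap_card: "card (diffs (inv\<^bsub>G\<^esub> g)) = card (diffs g)" if g: "g \<in> carrier G" for g
  proof -
    have "bij_betw prod.swap (diffs g) (diffs (inv\<^bsub>G\<^esub> g))"
    proof (rule bij_betw_byWitness[where f' = prod.swap])
      show "prod.swap ` diffs g \<subseteq> diffs (inv\<^bsub>G\<^esub> g)" using swap_mem by auto
      show "prod.swap ` diffs (inv\<^bsub>G\<^esub> g) \<subseteq> diffs g"
        using swap_mem[of _ _ "inv\<^bsub>G\<^esub> g"] g by auto
    qed auto
    thus ?thesis by (simp add: bij_betw_same_card)
  qed
  have D_inv: "inv\<^bsub>G\<^esub> x \<in> D" if x: "x \<in> D" for x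
  proof (rule ccontr)
    assume nin: "inv\<^bsub>G\<^esub> x \<notin> D"
    hence x1: "x \<noteq> \<one>\<^bsub>G\<^esub>" using x by auto
    have "inv\<^bsub>G\<^esub> x \<noteq> \<one>\<^bsub>G\<^esub>" using x1 car[OF x] by (simp add: inv_eq_1_iff)
    hence "int (card (diffs (inv\<^bsub>G\<^esub> x))) = mu" using cnt[of "inv\<^bsub>G\<^esub> x"] car[OF x] nin by simp
    moreover have "int (card (diffs x)) = lam" using cnt[OF car[OF x] x1] x by simp
    ultimately show False using swap_card[OF car[OF x]] neq by simp
  qed
  have one: "\<one>\<^bsub>G\<^esub> \<notin> D"
  proof
    assume one: "\<one>\<^bsub>G\<^esub> \<in> D"
    let ?P = "{p \<in> D \<times> D. fst p \<noteq> snd p}"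
    have finP: "finite ?P" using finD by simp
    have "?P = D \<times> D - (\<lambda>x. (x, x)) ` D" by auto
    moreover have "card ((\<lambda>x. (x, x)) ` D) = card D" by (intro card_image inj_onI) auto
    moreover have "(\<lambda>x. (x, x)) ` D \<subseteq> D \<times> D" by auto
    moreover have "card D \<le> card D * card D" by simp
    ultimately have cardP: "int (card ?P) = int (card D) * int (card D) - int (card D)"
      using finD by (simp add: card_Diff_subset card_cartesian_product of_nat_diff)
    have "(\<Sum>g\<in>carrier G - {\<one>\<^bsub>G\<^esub>}. \<Sum>p\<in>{p \<in> ?P. fst p \<otimes>\<^bsub>G\<^esub> inv\<^bsub>G\<^esub> snd p = g}. 1::int) = (\<Sum>p\<in>?P. 1)"
      using finP fin by (intro sum.group) (auto simp: car eq_one)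
    hence "int (card ?P) = (\<Sum>g\<in>carrier G - {\<one>\<^bsub>G\<^esub>}. \<Sum>p\<in>{p \<in> ?P. fst p \<otimes>\<^bsub>G\<^esub> inv\<^bsub>G\<^esub> snd p = g}. 1)"
      by simp
    also have "\<dots> = (\<Sum>g\<in>carrier G - {\<one>\<^bsub>G\<^esub>}. if g \<in> D then lam else mu)"
    proof (rule sum.cong[OF refl])
      fix g assume g: "g \<in> carrier G - {\<one>\<^bsub>G\<^esub>}"
      have "{p \<in> ?P. fst p \<otimes>\<^bsub>G\<^esub> inv\<^bsub>G\<^esub> snd p = g} = diffs g" by (auto simp: diffs_def)
      thus "(\<Sum>p\<in>{p \<in> ?P. fst p \<otimes>\<^bsub>G\<^esub> inv\<^bsub>G\<^esub> snd p = g}. 1) = (if g \<in> D then lam else mu)"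
        using cnt[of g] g by simp
    qed
    also have "\<dots> = lam * int (card (D - {\<one>\<^bsub>G\<^esub>})) + mu * int (card (carrier G - D))"
    proof -
      have "(carrier G - {\<one>\<^bsub>G\<^esub>}) \<inter> D = D - {\<one>\<^bsub>G\<^esub>}" "(carrier G - {\<one>\<^bsub>G\<^esub>}) \<inter> - D = carrier G - D"
        using sub one by auto
      thus ?thesis using fin by (simp add: sum.If_cases)
    qed
    also have "int (card (D - {\<one>\<^bsub>G\<^esub>})) = int (card D) - 1"
      using card.remove[OF finD one] by simp
    also have "int (card (carrier G - D)) = (int n)\<^sup>2 - int (card D)"
      using sub finD ord card_mono[OF fin sub] by (simp add: card_Diff_subset of_nat_diff)
    finally have "(r * (int n - eps)) * (r * (int n - eps)) - r * (int n - eps) =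
        lam * (r * (int n - eps) - 1) + mu * ((int n)\<^sup>2 - r * (int n - eps))"
      unfolding cardP card .
    \<comment> \<open>The parameters satisfy the pair count of an identity-free set. An identity in
      \<open>D\<close> would trade one \<open>lam\<close> for one \<open>mu\<close>, making them
      equal.\<close>
    moreover have "(r * (int n - eps)) * (r * (int n - eps)) - r * (int n - eps) =
        lam * (r * (int n - eps)) + mu * ((int n)\<^sup>2 - 1 - r * (int n - eps))"
      using eps unfolding lam_def mu_def by (auto simp: power2_eq_square algebra_simps)
    ultimately have "lam * (r * (int n - eps) - 1) + mu * ((int n)\<^sup>2 - r * (int n - eps)) =
        lam * (r * (int n - eps)) + mu * ((int n)\<^sup>2 - 1 - r * (int n - eps))"
      by (rule trans[OF sym])
    hence "lam = mu" by (simp add: right_diff_distrib)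
    thus False using neq by simp
  qed
  have prods: "int (card {(x, y). x \<in> D \<and> y \<in> D \<and> x \<otimes>\<^bsub>G\<^esub> y = g}) =
      (int n * r - r\<^sup>2) * of_bool (g = \<one>\<^bsub>G\<^esub>) + eps * (int n - 2 * r) * of_bool (g \<in> D) + (r\<^sup>2 - eps * r)"
    if g: "g \<in> carrier G" for g
  proof -
    have bij: "bij_betw (\<lambda>(x, y). (x, inv\<^bsub>G\<^esub> y)) {(x, y). x \<in> D \<and> y \<in> D \<and> x \<otimes>\<^bsub>G\<^esub> inv\<^bsub>G\<^esub> y = g}
        {(x, y). x \<in> D \<and> y \<in> D \<and> x \<otimes>\<^bsub>G\<^esub> y = g}"
      by (rule bij_betw_byWitness[where f' = "\<lambda>(x, y). (x, inv\<^bsub>G\<^esub> y)"]) (auto simp: D_inv car)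
    show ?thesis
    proof (cases "g = \<one>\<^bsub>G\<^esub>")
      case True
      have "{(x, y). x \<in> D \<and> y \<in> D \<and> x \<otimes>\<^bsub>G\<^esub> inv\<^bsub>G\<^esub> y = g} = (\<lambda>x. (x, x)) ` D"
        using eq_one True by auto
      moreover have "card ((\<lambda>x. (x, x)) ` D) = card D" by (intro card_image inj_onI) auto
      ultimately show ?thesis
        using bij_betw_same_card[OF bij] card one True by (simp add: algebra_simps)
    next
      case False
      have "{(x, y). x \<in> D \<and> y \<in> D \<and> x \<otimes>\<^bsub>G\<^esub> inv\<^bsub>G\<^esub> y = g} = diffs g"
        using eq_one False by (auto simp: diffs_def)
      thus ?thesis
        using bij_betw_same_card[OF bij] cnt[OF g False] False
        by (simp add: lam_def mu_def algebra_simps)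
    qed
  qed
  show ?thesis
  proof (rule latin_pds.intro[OF G latin_pds_axioms.intro])
    show "order G = n\<^sup>2" using ord by (simp add: order_def)
    show "D \<subseteq> carrier G - {\<one>\<^bsub>G\<^esub>}" using sub one by auto
  qed (fact fin n eps D_inv card prods)+
qed

section \<open>Bounds\<close>

text \<open>The point \<open>(p, q)\<close> lies in two discs centred at \<open>(0, 0)\<close> and
  \<open>(s, s)\<close>, of radii \<open>u\<close> and \<open>s - u\<close> times the square root of
  2; these touch only at \<open>(u, u)\<close>.\<close>

lemma two_sided_squares_eq:
  fixes p q s u :: int
  assumes pq: "p\<^sup>2 + q\<^sup>2 \<le> 2 * u\<^sup>2" "(s - p)\<^sup>2 + (s - q)\<^sup>2 \<le> 2 * (s - u)\<^sup>2"
    and u: "0 \<le> u" "u \<le> s"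
  shows "p = u"
proof -
  have bound: "x + y \<le> 2 * z" if "x\<^sup>2 + y\<^sup>2 \<le> 2 * z\<^sup>2" "0 \<le> z" for x y z :: int
  proof -
    have "(x + y)\<^sup>2 + (x - y)\<^sup>2 \<le> (2 * z)\<^sup>2" using that(1) by (simp add: power2_eq_square algebra_simps)
    hence "(x + y)\<^sup>2 \<le> (2 * z)\<^sup>2" by (smt (verit) zero_le_power2)
    thus ?thesis using that(2) by (metis abs_le_square_iff abs_le_D1 abs_of_nonneg mult_nonneg_nonneg zero_le_numeral)
  qed
  have "p + q \<le> 2 * u" using bound pq(1) u by simp
  moreover have "(s - p) + (s - q) \<le> 2 * (s - u)" using bound[OF pq(2)] u by simp
  ultimately have q: "q = 2 * u - p" by simp
  have "2 * (p - u)\<^sup>2 \<le> 0" using pq(1) unfolding q by (simp add: power2_eq_square algebra_simps)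
  thus ?thesis by simp
qed

text \<open>Adding the inequalities for \<open>k\<close> and \<open>l\<close> and completing squares
  confines \<open>(k, l)\<close> to a disc for each \<open>v\<close>. In the stated range of
  \<open>r - a * v\<close> the discs for \<open>v\<close> and \<open>v + 1\<close> are tangent, and
  \<open>k\<close> is read off at the contact point.\<close>

lemma card_torsion_part_eq:
  fixes a r eps k l v :: int
  assumes a: "a > 0" and eps: "eps = 1 \<or> eps = -1"
    and k: "\<And>v. a\<^sup>2 * (if even v then l else a\<^sup>2 - 1 - l) \<le>
        a\<^sup>2 * k - k\<^sup>2 - 2 * eps * (r - a * v) * k + (a\<^sup>2 - 1) * (r - a * v)\<^sup>2"
    and l: "\<And>v. a\<^sup>2 * (if even v then k else a\<^sup>2 - 1 - k) \<le>
        a\<^sup>2 * l - l\<^sup>2 - 2 * eps * (r - a * v) * l + (a\<^sup>2 - 1) * (r - a * v)\<^sup>2"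
    and d: "0 \<le> r - a * v" "eps \<le> r - a * v" "r - a * v \<le> a" "r - a * v \<le> a + eps"
  shows "k = (if even v then (a - eps) * (r - a * v) else (a + eps) * (a - (r - a * v)))"
proof -
  have ev: "(k + eps * (r - a * v))\<^sup>2 + (l + eps * (r - a * v))\<^sup>2 \<le> 2 * (a * (r - a * v))\<^sup>2"
    if "even v" for v
    using k[of v] l[of v] that eps by (auto simp: power2_eq_square algebra_simps)
  have od: "(a\<^sup>2 - k - eps * (r - a * v))\<^sup>2 + (a\<^sup>2 - l - eps * (r - a * v))\<^sup>2
      \<le> 2 * (a * (r - a * v - eps))\<^sup>2" if "odd v" for v
    using k[of v] l[of v] that eps by (auto simp: power2_eq_square algebra_simps)
  show ?thesis
  proof (cases "even v")
    case True
    \<comment> \<open>The centres for \<open>v\<close> and \<open>v + 1\<close> differ by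
      \<open>a\<^sup>2 + eps * a\<close> in each coordinate; for odd \<open>v\<close> the difference
      is \<open>a\<^sup>2 - eps * a\<close>.\<close>
    have "k + eps * (r - a * v) = a * (r - a * v)"
    proof (rule two_sided_squares_eq[OF ev[OF True], of "a\<^sup>2 + eps * a"])
      show "(a\<^sup>2 + eps * a - (k + eps * (r - a * v)))\<^sup>2 + (a\<^sup>2 + eps * a - (l + eps * (r - a * v)))\<^sup>2
          \<le> 2 * (a\<^sup>2 + eps * a - a * (r - a * v))\<^sup>2"
        using od[of "v + 1"] True by (simp add: power2_eq_square algebra_simps)
      show "0 \<le> a * (r - a * v)" using a d by simp
      have "a * (r - a * v) \<le> a * (a + eps)" using a d by (intro mult_left_mono) auto
      thus "a * (r - a * v) \<le> a\<^sup>2 + eps * a" by (simp add: power2_eq_square algebra_simps)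
    qed
    thus ?thesis using True by (simp add: algebra_simps)
  next
    case False
    have "a\<^sup>2 - k - eps * (r - a * v) = a * (r - a * v - eps)"
    proof (rule two_sided_squares_eq[OF od[OF False], of "a\<^sup>2 - eps * a"])
      show "(a\<^sup>2 - eps * a - (a\<^sup>2 - k - eps * (r - a * v)))\<^sup>2 +
          (a\<^sup>2 - eps * a - (a\<^sup>2 - l - eps * (r - a * v)))\<^sup>2
          \<le> 2 * (a\<^sup>2 - eps * a - a * (r - a * v - eps))\<^sup>2"
        using ev[of "v + 1"] False by (simp add: power2_eq_square algebra_simps)
      show "0 \<le> a * (r - a * v - eps)" using a d by simp
      have "a * (r - a * v - eps) \<le> a * (a - eps)" using a d by (intro mult_left_mono) auto
      thus "a * (r - a * v - eps) \<le> a\<^sup>2 - eps * a" by (simp add: power2_eq_square algebra_simps)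
    qed
    thus ?thesis using False by (simp add: power2_eq_square algebra_simps)
  qed
qed

section \<open>From torsion counts to bounds on \<open>r\<close>\<close>

lemma dual_part_eq:
  fixes a b r eps k m v :: int
  assumes a: "a > 0" and eps: "eps = 1 \<or> eps = -1"
    and k: "k = (if even v then (a - eps) * (r - a * v) else (a + eps) * (a - (r - a * v)))"
    and m: "b * k = r * a + eps * (a * m - r * b)"
  shows "m = eps * (if even v then (b - 1) * r - (a - eps) * b * v
    else (a + eps) * b * (v + 1) - (b + 1) * r)" (is "m = ?M")
proof -
  have "a * m = a * ?M"
    using eps m[unfolded k] by (cases "even v") (auto simp: algebra_simps power2_eq_square)
  thus ?thesis using a by simp
qed

lemma interval_bounds:
  fixes B N y r :: real
  assumes "B > 0"
  shows "0 \<le> N - B * r \<Longrightarrow> N - B * r \<le> B * y \<Longrightarrow> N / B - y \<le> r \<and> r \<le> N / B"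
    and "0 \<le> B * r - N \<Longrightarrow> B * r - N \<le> B * y \<Longrightarrow> N / B \<le> r \<and> r \<le> N / B + y"
  using assms by (auto simp: field_simps)

text \<open>\<open>M\<close> is the number of elements of \<open>dual_set\<close> in the
  \<open>b\<^sup>2\<close>-torsion of the character group, which has \<open>b\<^sup>2 - 1\<close>
  nontrivial elements.\<close>

lemma dual_torsion_card_bounds:
  fixes a b :: nat and r eps v :: int
  assumes D: "latin_pds G D (a * b) r eps"
    and ab: "coprime a b" "odd b"
    and d: "0 \<le> r - int a * v" "eps \<le> r - int a * v" "r - int a * v \<le> int a" "r - int a * v \<le> int a + eps"
  defines "M \<equiv> eps * (if even v then (int b - 1) * r - (int a - eps) * int b * v
    else (int a + eps) * int b * (v + 1) - (int b + 1) * r)"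
  shows "0 \<le> M" "M \<le> (int b)\<^sup>2 - 1"
proof -
  interpret latin_pds G D "a * b" r eps by (rule D)
  let ?C = "character_group G" and ?w = "\<lambda>x \<chi>. \<chi> x :: complex"
  interpret dual_pair G ?C ?w by (rule dual_pair_character_group[OF finite_carrier])
  interpret latin_pds_dual G D "a * b" r eps ?C ?w ..
  interpret P: pds_pair G ?C ?w a b r eps D dual_set by (rule pds_pairs(1)[OF refl ab])
  interpret Q: pds_pair ?C G "\<lambda>c x. ?w x c" a b r eps dual_set D by (rule pds_pairs(2)[OF refl ab])
  let ?k = "int (card (D \<inter> torsion G (a\<^sup>2)))"
  let ?m = "int (card (dual_set \<inter> torsion ?C (b\<^sup>2)))"
  have k: "?k = (if even v then (int a - eps) * (r - int a * v) else (int a + eps) * (int a - (r - int a * v)))"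
    by (rule card_torsion_part_eq[OF _ eps P.variance_bound Q.variance_bound d]) (use P.a_pos in simp)
  have "?m = M"
    unfolding M_def by (rule dual_part_eq[OF _ eps k P.card_torsion_S]) (use P.a_pos in simp)
  moreover have "card (dual_set \<inter> torsion ?C (b\<^sup>2)) \<le> card (torsion ?C (b\<^sup>2) - {\<one>\<^bsub>?C\<^esub>})"
    using P.T_subset P.finite_sets(5) by (intro card_mono) auto
  moreover have "card (torsion ?C (b\<^sup>2) - {\<one>\<^bsub>?C\<^esub>}) = b\<^sup>2 - 1"
    using subgroup.one_closed[OF comm_group.torsion_subgroup[OF comm_group_character_group]] by (simp add: P.card_HB)
  moreover have "int (b\<^sup>2 - 1) = (int b)\<^sup>2 - 1" using P.b_pos by (simp add: of_nat_diff)
  ultimately show "0 \<le> M" "M \<le> (int b)\<^sup>2 - 1" by linarith+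
qed

theorem theorem2:
  fixes G :: "('a, 'b) monoid_scheme" and D :: "'a set"
    and a b :: nat and r t eps :: int
  assumes G: "comm_group G" "finite (carrier G)"
    and ord: "order G = a^2 * b^2"
    and ab: "gcd a b = 1" "a > 1" "odd b" "b \<ge> 3"
    and eps: "eps \<in> {1, -1}"
    and D: "pds G D (int (a^2 * b^2)) (r * (int a * int b - eps))
              (eps * int a * int b + r^2 - 3 * eps * r) (r^2 - eps * r)"
    and t: "real_of_int t \<le> (real_of_int eps * a * b - 2 * real_of_int eps * r + a) / (2 * a)"
           "(real_of_int eps * a * b - 2 * real_of_int eps * r + a) / (2 * a) < real_of_int t + 1"
  shows "(eps = 1 \<longrightarrow>
            ((real (a+1) * b * (b + 1 - 2 * t) / (2 * (b + 1)) - (b - 1) \<le> r \<and>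
              r \<le> real (a+1) * b * (b + 1 - 2 * t) / (2 * (b + 1))) \<or>
             (real (a-1) * b * (b - 1 - 2 * t) / (2 * (b - 1)) \<le> r \<and>
              r \<le> real (a-1) * b * (b - 1 - 2 * t) / (2 * (b - 1)) + (b + 1))))
       \<and> (eps = -1 \<longrightarrow>
            ((real (a+1) * b * (b - 1 + 2 * t) / (2 * (b - 1)) - (b + 1) \<le> r \<and>
              r \<le> real (a+1) * b * (b - 1 + 2 * t) / (2 * (b - 1))) \<or>
             (real (a-1) * b * (b + 1 + 2 * t) / (2 * (b + 1)) \<le> r \<and>
              r \<le> real (a-1) * b * (b + 1 + 2 * t) / (2 * (b + 1)) + (b - 1))))"
proof -
  define A B T R where "A = real a" and "B = real b" and "T = real_of_int t" and "R = real_of_int r"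
  have e: "eps = 1 \<or> eps = -1" using eps by simp
  have B3: "B \<ge> 3" using ab by (simp add: B_def)
  obtain \<beta> where \<beta>: "b = 2 * \<beta> + 1" using ab(3) by (auto elim: oddE)
  have tt: "2 * int a * t \<le> eps * (int a * int b - 2 * r) + int a"
    "eps * (int a * int b - 2 * r) + int a < 2 * int a * t + 2 * int a"
  proof -
    have "real_of_int (2 * int a * t) \<le> real_of_int (eps * (int a * int b - 2 * r) + int a)"
      using t(1) ab(2) by (simp add: field_simps)
    thus "2 * int a * t \<le> eps * (int a * int b - 2 * r) + int a" by (simp only: of_int_le_iff)
    have "real_of_int (eps * (int a * int b - 2 * r) + int a) < real_of_int (2 * int a * t + 2 * int a)"
      using t(2) ab(2) by (simp add: field_simps)
    thus "eps * (int a * int b - 2 * r) + int a < 2 * int a * t + 2 * int a" by (simp only: of_int_less_iff)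
  qed
  have main: "(eps = 1 \<longrightarrow>
      (((A + 1) * B * (B + 1 - 2 * T)) / (2 * (B + 1)) - (B - 1) \<le> R \<and>
       R \<le> ((A + 1) * B * (B + 1 - 2 * T)) / (2 * (B + 1))) \<or>
      (((A - 1) * B * (B - 1 - 2 * T)) / (2 * (B - 1)) \<le> R \<and>
       R \<le> ((A - 1) * B * (B - 1 - 2 * T)) / (2 * (B - 1)) + (B + 1))) \<and>
    (eps = -1 \<longrightarrow>
      (((A + 1) * B * (B - 1 + 2 * T)) / (2 * (B - 1)) - (B + 1) \<le> R \<and>
       R \<le> ((A + 1) * B * (B - 1 + 2 * T)) / (2 * (B - 1))) \<or>
      (((A - 1) * B * (B + 1 + 2 * T)) / (2 * (B + 1)) \<le> R \<and>
       R \<le> ((A - 1) * B * (B + 1 + 2 * T)) / (2 * (B + 1)) + (B - 1)))"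
  proof (cases "int (a * b) = 2 * r")
    case True
    \<comment> \<open>The degenerate case of equal multiplicities: \<open>t\<close> is 0, and
      \<open>R = A * B / 2\<close> lies \<open>B / 2\<close> below the upper bound of the first
      alternative for either sign.\<close>
    have "int a * (2 * t) \<le> int a * 1" "int a * 1 < int a * (2 * t + 2)"
      using tt True by (simp_all add: algebra_simps)
    hence "2 * t \<le> 1" "1 < 2 * t + 2" using ab(2) by simp_all
    hence t0: "T = 0" by (simp add: T_def)
    have "real_of_int (int (a * b)) = real_of_int (2 * r)" using True by (simp only:)
    hence R: "R = A * B / 2" by (simp add: A_def B_def R_def)
    have "(A + 1) * B * (B + 1 - 2 * 0) / (2 * (B + 1)) = (A * B + B) / 2"
      "(A + 1) * B * (B - 1 + 2 * 0) / (2 * (B - 1)) = (A * B + B) / 2"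
      using B3 by (simp_all add: field_simps)
    thus ?thesis unfolding t0 R using B3 by simp
  next
    case False
    have L: "latin_pds G D (a * b) r eps"
    proof (rule pds_latin_pds[OF G(1) _ e _ False])
      show "1 < a * b" using ab less_1_mult[of a b] by simp
      show "pds G D (int ((a * b)\<^sup>2)) (r * (int (a * b) - eps))
          (eps * int (a * b) + r\<^sup>2 - 3 * eps * r) (r\<^sup>2 - eps * r)"
        using D by (simp add: power_mult_distrib mult.assoc)
    qed
    have cop: "coprime a b" using ab(1) by (simp add: coprime_iff_gcd_eq_1)
    note bounds = dual_torsion_card_bounds[OF L cop ab(3)]
    from e show ?thesis
    proof
      assume eps1: "eps = 1"
      \<comment> \<open>With \<open>b = 2 * \<beta> + 1\<close>, the condition on \<open>t\<close>
        says precisely that \<open>r - a * v\<close> lies between 1 and \<open>a\<close>, the range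
        required for tangency.\<close>
      define v where "v = int \<beta> - t"
      have V: "2 * real_of_int v = B - 1 - 2 * T" by (simp add: v_def B_def T_def \<beta>)
      have d1: "int a * (2 * t) \<le> int a * int b - 2 * r + int a" "int a * int b - 2 * r + int a < int a * (2 * t + 2)"
        using tt eps1 by (simp_all add: algebra_simps)
      have d: "1 \<le> r - int a * v" "r - int a * v \<le> int a"
        using d1 unfolding v_def \<beta> by (simp_all add: algebra_simps)
      \<comment> \<open>Even \<open>v\<close> yields the second alternative and odd \<open>v\<close>
        the first; factoring \<open>b\<^sup>2 - 1\<close> gives the interval lengths
        \<open>b + 1\<close> and \<open>b - 1\<close>.\<close>
      show ?thesis
      proof (cases "even v")
        case True
        let ?M = "(int b - 1) * r - (int a - 1) * int b * v"
        have "0 \<le> real_of_int ?M" "real_of_int ?M \<le> real_of_int ((int b)\<^sup>2 - 1)"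
          unfolding of_int_le_iff of_int_0_le_iff using bounds[of v] d eps1 True by auto
        moreover have "2 * real_of_int ?M = 2 * (B - 1) * R - (A - 1) * B * (B - 1 - 2 * T)"
          unfolding V[symmetric] by (simp add: A_def B_def R_def algebra_simps)
        moreover have "2 * real_of_int ((int b)\<^sup>2 - 1) = 2 * (B - 1) * (B + 1)"
          by (simp add: B_def power2_eq_square algebra_simps)
        ultimately show ?thesis
          using interval_bounds(2)[of "2 * (B - 1)" R "(A - 1) * B * (B - 1 - 2 * T)" "B + 1"] B3 eps1
          by simp
      next
        case False
        let ?M = "(int a + 1) * int b * (v + 1) - (int b + 1) * r"
        have "0 \<le> real_of_int ?M" "real_of_int ?M \<le> real_of_int ((int b)\<^sup>2 - 1)"
          unfolding of_int_le_iff of_int_0_le_iff using bounds[of v] d eps1 False by auto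
        moreover have V': "2 * (real_of_int v + 1) = B + 1 - 2 * T" using V by simp
        have "2 * real_of_int ?M = (A + 1) * B * (B + 1 - 2 * T) - 2 * (B + 1) * R"
          unfolding V'[symmetric] by (simp add: A_def B_def R_def algebra_simps)
        moreover have "2 * real_of_int ((int b)\<^sup>2 - 1) = 2 * (B + 1) * (B - 1)"
          by (simp add: B_def power2_eq_square algebra_simps)
        ultimately show ?thesis
          using interval_bounds(1)[of "2 * (B + 1)" "(A + 1) * B * (B + 1 - 2 * T)" R "B - 1"] B3 eps1
          by simp
      qed
    next
      assume eps1: "eps = -1"
      \<comment> \<open>For \<open>eps = -1\<close> the sign of \<open>t\<close> flips and
        \<open>r - a * v\<close> lies between 0 and \<open>a - 1\<close>; now even \<open>v\<close>
        yields the first alternative and odd \<open>v\<close> the second.\<close>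
      define v where "v = int \<beta> + t"
      have V: "2 * real_of_int v = B - 1 + 2 * T" by (simp add: v_def B_def T_def \<beta>)
      have d1: "int a * (2 * t) \<le> 2 * r - int a * int b + int a" "2 * r - int a * int b + int a < int a * (2 * t + 2)"
        using tt eps1 by (simp_all add: algebra_simps)
      have d: "0 \<le> r - int a * v" "r - int a * v \<le> int a - 1"
        using d1 unfolding v_def \<beta> by (simp_all add: algebra_simps)
      show ?thesis
      proof (cases "even v")
        case True
        let ?M = "(int a + 1) * int b * v - (int b - 1) * r"
        have "0 \<le> real_of_int ?M" "real_of_int ?M \<le> real_of_int ((int b)\<^sup>2 - 1)"
          unfolding of_int_le_iff of_int_0_le_iff using bounds[of v] d eps1 True by auto
        moreover have "2 * real_of_int ?M = (A + 1) * B * (B - 1 + 2 * T) - 2 * (B - 1) * R"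
          unfolding V[symmetric] by (simp add: A_def B_def R_def algebra_simps)
        moreover have "2 * real_of_int ((int b)\<^sup>2 - 1) = 2 * (B - 1) * (B + 1)"
          by (simp add: B_def power2_eq_square algebra_simps)
        ultimately show ?thesis
          using interval_bounds(1)[of "2 * (B - 1)" "(A + 1) * B * (B - 1 + 2 * T)" R "B + 1"] B3 eps1
          by simp
      next
        case False
        let ?M = "(int b + 1) * r - (int a - 1) * int b * (v + 1)"
        have "0 \<le> real_of_int ?M" "real_of_int ?M \<le> real_of_int ((int b)\<^sup>2 - 1)"
          unfolding of_int_le_iff of_int_0_le_iff using bounds[of v] d eps1 False by auto
        moreover have V': "2 * (real_of_int v + 1) = B + 1 + 2 * T" using V by simp
        have "2 * real_of_int ?M = 2 * (B + 1) * R - (A - 1) * B * (B + 1 + 2 * T)"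
          unfolding V'[symmetric] by (simp add: A_def B_def R_def algebra_simps)
        moreover have "2 * real_of_int ((int b)\<^sup>2 - 1) = 2 * (B + 1) * (B - 1)"
          by (simp add: B_def power2_eq_square algebra_simps)
        ultimately show ?thesis
          using interval_bounds(2)[of "2 * (B + 1)" R "(A - 1) * B * (B + 1 + 2 * T)" "B - 1"] B3 eps1
          by simp
      qed
    qed
  qed
  \<comment> \<open>Subtraction of naturals is truncated, but exact here since \<open>a > 1\<close>
    and \<open>b \<ge> 3\<close>.\<close>
  have "real (a - 1) = A - 1" "real (b - 1) = B - 1" "real (a + 1) = A + 1"
    using ab by (simp_all add: A_def B_def of_nat_diff)
  thus ?thesis using main by (simp add: A_def B_def T_def R_def add.commute)
qed

end
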